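(* Let $A$ be a double Poisson algebra with bracket $\{\!\{-,-\}\!\}$ and corresponding necklace Lie algebra $\mathfrak{n}=A/[A,A]$. Let $\mathcal{N}=S(A/[A,A])$ be the necklace algebra of $A$ and $\mathcal{T}=\mathcal{N}\otimes_{\mathbb{C}}A$ the trace algebra of $A$. Consider the Lie-Poisson bracket $\{-,-\}$ induced by $\{\!\{-,-\}\!\}$ on $\mathcal{N}$, let $\tilde H$ be the map sending $w\in\mathcal{N}$ to the derivation $\{w,-\}$ of $\mathcal{N}$, and let $H:\mathcal{N}\to\mathrm{Der}_{\mathbb{C}}(\mathcal{T})$ be its extension to $\mathcal{T}$ using the Leibniz rule. Then $(\mathcal{T},\mathcal{N},H)$ is a formal Poisson order.
   Context: All associative algebras are unital over $\mathbb{C}$; $\otimes=\otimes_{\mathbb{C}}$. $A$ is an affine (finitely generated) associative $\mathbb{C}$-algebra. A double Poisson bracket on $A$ is a linear map $\{\!\{-,-\}\!\}:A\otimes A\to A\otimes A$ with: (1) $\{\!\{a,b\}\!\}=-\{\!\{b,a\}\!\}^o$, where $(u\otimes v)^o=v\otimes u$; (2) $\{\!\{a,bc\}\!\}=b.\{\!\{a,c\}\!\}+\{\!\{a,b\}\!\}.c$ for the outer action $a.(u\otimes v).c=(au)\otimes(vc)$; (3) writing $\{\!\{a,b\}\!\}=\{\!\{a,b\}\!\}'\otimes\{\!\{a,b\}\!\}''$ (summation suppressed) and letting $\sigma(a_1\otimes a_2\otimes a_3)=a_3\otimes a_1\otimes a_2$, $$\{\!\{a,\{\!\{b,c\}\!\}'\}\!\}\otimes\{\!\{b,c\}\!\}''+\sigma\big(\{\!\{b,\{\!\{c,a\}\!\}'\}\!\}\otimes\{\!\{c,a\}\!\}''\big)+\sigma^{-1}\big(\{\!\{c,\{\!\{a,b\}\!\}'\}\!\}\otimes\{\!\{a,b\}\!\}''\big)=0.$$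 An algebra with a double Poisson bracket is a double Poisson algebra. With $\mu$ the multiplication, put $\{a,b\}_L=\mu(\{\!\{a,b\}\!\})$; it is a derivation in the second argument, depends on $a$ only modulo $[A,A]$ (the span of all commutators), and induces a Lie bracket on $\mathfrak{n}=A/[A,A]$, hence a Lie-Poisson bracket on $\mathcal{N}=S(\mathfrak{n})$. The map $H$: for $w\in\mathfrak{n}$, $H(w)$ is the derivation of $\mathcal{T}=\mathcal{N}\otimes A$ with $H(w)(z\otimes1)=\{w,z\}\otimes1$ for $z\in\mathcal{N}$ and $H(w)(1\otimes a)=1\otimes\{\tilde w,a\}_L$ for $a\in A$, where $\tilde w\in A$ is any lift of $w$; it is extended to all of $\mathcal{N}$ by linearity and $H(zz')=zH(z')+z'H(z)$. Formal Poisson order: a triple $(B,Z,H)$ with $B$ an algebra, $Z$ a central subalgebra of $B$, $H:Z\to\mathrm{Der}_{\mathbb{C}}(B)$ a linear map satisfying the Leibniz identity $H(zz')=zH(z')+z'H(z)$, such that $H|_Z$ defines a Poisson structure on $Z$, i.e. $\{z,z'\}:=H(z)(z')$ is a Poisson bracket on $Z$. *)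

theory Defs
  imports Complex_Main "HOL-Library.Poly_Mapping"
begin

section \<open>Complex vector spaces and unital algebras\<close>

text \<open>Algebras are whole types; as in \<^class>\<open>ring_1\<close>, a unital algebra satisfies \<open>0 \<noteq> 1\<close>.\<close>

class scaleC =
  fixes scaleC :: "complex \<Rightarrow> 'a \<Rightarrow> 'a"  (infixr "*\<^sub>C" 75)

class complex_vector = scaleC + ab_group_add +
  assumes scaleC_add_right: "c *\<^sub>C (x + y) = c *\<^sub>C x + c *\<^sub>C y"
    and scaleC_add_left: "(c + d) *\<^sub>C x = c *\<^sub>C x + d *\<^sub>C x"
    and scaleC_scaleC: "c *\<^sub>C d *\<^sub>C x = (c * d) *\<^sub>C x"
    and scaleC_one: "1 *\<^sub>C x = x"

class complex_algebra_1 = complex_vector + ring_1 +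
  assumes mult_scaleC_left [simp]: "c *\<^sub>C x * y = c *\<^sub>C (x * y)"
    and mult_scaleC_right [simp]: "x * c *\<^sub>C y = c *\<^sub>C (x * y)"

instantiation complex :: complex_algebra_1
begin

definition scaleC_complex_def [simp]: "scaleC c x = c * (x::complex)"

instance
  by standard (simp_all add: algebra_simps)

end

global_interpretation complex_vector: vector_space "scaleC :: complex \<Rightarrow> 'a \<Rightarrow> 'a::complex_vector"
  by unfold_locales (rule scaleC_add_right scaleC_add_left scaleC_scaleC scaleC_one)+

global_interpretation complex_vector: vector_space_pair
  "scaleC :: complex \<Rightarrow> 'a \<Rightarrow> 'a::complex_vector"
  "scaleC :: complex \<Rightarrow> 'b \<Rightarrow> 'b::complex_vector"
  by unfold_locales

abbreviation clinear :: "('a::complex_vector \<Rightarrow> 'b::complex_vector) \<Rightarrow> bool"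
  where "clinear \<equiv> Vector_Spaces.linear scaleC scaleC"

definition cbilinear :: "('a::complex_vector \<Rightarrow> 'b::complex_vector \<Rightarrow> 'c::complex_vector) \<Rightarrow> bool"
  where "cbilinear f \<longleftrightarrow> (\<forall>x. clinear (f x)) \<and> (\<forall>y. clinear (\<lambda>x. f x y))"

definition subalgebra :: "'a::complex_algebra_1 set \<Rightarrow> bool"
  where "subalgebra B \<longleftrightarrow> 1 \<in> B \<and> (\<forall>x\<in>B. \<forall>y\<in>B. x + y \<in> B \<and> x * y \<in> B) \<and>
    (\<forall>c. \<forall>x\<in>B. c *\<^sub>C x \<in> B)"

definition derivation :: "('a::complex_algebra_1 \<Rightarrow> 'a) \<Rightarrow> bool"
  where "derivation D \<longleftrightarrow> clinear D \<and> (\<forall>x y. D (x * y) = D x * y + x * D y)"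

lemma clinearI:
  assumes "\<And>x y. f (x + y) = f x + f y" "\<And>c x. f (c *\<^sub>C x) = c *\<^sub>C f x"
  shows "clinear f"
  using assms
  by (simp add: Vector_Spaces.linear_def module_hom_def module_hom_axioms_def
      complex_vector.module_axioms complex_vector.vector_space_axioms)

lemma clinear_add: "clinear f \<Longrightarrow> f (x + y) = f x + f y"
  by (rule complex_vector.linear_add)

lemma clinear_scale: "clinear f \<Longrightarrow> f (c *\<^sub>C x) = c *\<^sub>C f x"
  by (rule complex_vector.linear_scale)

lemma cbilinearI:
  assumes "\<And>x x' y. f (x + x') y = f x y + f x' y" "\<And>x y y'. f x (y + y') = f x y + f x y'"
    and "\<And>c x y. f (c *\<^sub>C x) y = c *\<^sub>C f x y" "\<And>c x y. f x (c *\<^sub>C y) = c *\<^sub>C f x y"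
  shows "cbilinear f"
  unfolding cbilinear_def by (auto intro!: clinearI simp: assms)

lemma cbilinearD:
  assumes "cbilinear f"
  shows "f (x + x') y = f x y + f x' y" "f x (y + y') = f x y + f x y'"
    and "f (c *\<^sub>C x) y = c *\<^sub>C f x y" "f x (c *\<^sub>C y) = c *\<^sub>C f x y"
proof -
  have 1: "clinear (f x)" and 2: "clinear (\<lambda>x. f x y)" for x y
    using assms by (auto simp: cbilinear_def)
  show "f (x + x') y = f x y + f x' y" "f (c *\<^sub>C x) y = c *\<^sub>C f x y"
    using clinear_add[OF 2] clinear_scale[OF 2] by auto
  show "f x (y + y') = f x y + f x y'" "f x (c *\<^sub>C y) = c *\<^sub>C f x y"
    using clinear_add[OF 1] clinear_scale[OF 1] by auto
qed

lemma exists_functional: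
  fixes x :: "'a::complex_vector"
  assumes "x \<noteq> 0"
  shows "\<exists>f :: 'a \<Rightarrow> complex. clinear f \<and> f x = 1"
proof -
  have "complex_vector.independent {x}"
    using assms by (simp add: complex_vector.dependent_single)
  from complex_vector.linear_independent_extend[OF this, of "\<lambda>_. 1 :: complex"]
  show ?thesis by auto
qed

instantiation poly_mapping :: (type, complex_vector) complex_vector
begin

lift_definition scaleC_poly_mapping :: "complex \<Rightarrow> ('a \<Rightarrow>\<^sub>0 'b) \<Rightarrow> ('a \<Rightarrow>\<^sub>0 'b)"
  is "\<lambda>c f k. c *\<^sub>C f k"
  by (erule finite_subset[rotated]) auto

instance
  by standard (transfer; simp add: fun_eq_iff scaleC_add_right scaleC_add_left scaleC_scaleC scaleC_one)+

end

lemma lookup_scaleC [simp]: "Poly_Mapping.lookup (c *\<^sub>C p) k = c *\<^sub>C Poly_Mapping.lookup p k"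
  by transfer simp

section \<open>Tensor products over the complex numbers\<close>

text \<open>The tensor product is the free vector space on pairs modulo the usual bilinearity relations.\<close>

inductive_set tensor_relators :: "('a::complex_vector \<times> 'b::complex_vector \<Rightarrow>\<^sub>0 complex) set"
  where
    add_left: "Poly_Mapping.single (a + a', b) 1 -
      (Poly_Mapping.single (a, b) 1 + Poly_Mapping.single (a', b) 1) \<in> tensor_relators"
  | add_right: "Poly_Mapping.single (a, b + b') 1 -
      (Poly_Mapping.single (a, b) 1 + Poly_Mapping.single (a, b') 1) \<in> tensor_relators"
  | scale_left: "Poly_Mapping.single (c *\<^sub>C a, b) 1 - c *\<^sub>C Poly_Mapping.single (a, b) 1 \<in> tensor_relators"
  | scale_right: "Poly_Mapping.single (a, c *\<^sub>C b) 1 - c *\<^sub>C Poly_Mapping.single (a, b) 1 \<in> tensor_relators"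

lemma equivp_mod_span: "equivp (\<lambda>x y. x - y \<in> complex_vector.span S)"
proof (rule equivpI)
  show "reflp (\<lambda>x y. x - y \<in> complex_vector.span S)"
    by (simp add: reflp_def complex_vector.span_zero)
  show "symp (\<lambda>x y. x - y \<in> complex_vector.span S)"
    using complex_vector.span_neg by (force simp: symp_def)
  show "transp (\<lambda>x y. x - y \<in> complex_vector.span S)"
    using complex_vector.span_add by (force simp: transp_def)
qed

quotient_type (overloaded) ('a, 'b) tensor =
    "('a::complex_vector \<times> 'b::complex_vector) \<Rightarrow>\<^sub>0 complex" /
    "\<lambda>x y. x - y \<in> complex_vector.span tensor_relators"
  by (rule equivp_mod_span)

lemma mod_span_add:
  "x - x' \<in> complex_vector.span S \<Longrightarrow> y - y' \<in> complex_vector.span S \<Longrightarrow>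
    x + y - (x' + y') \<in> complex_vector.span S"
  using complex_vector.span_add[of "x - x'" S "y - y'"] by (simp add: algebra_simps)

lemma mod_span_diff:
  "x - x' \<in> complex_vector.span S \<Longrightarrow> y - y' \<in> complex_vector.span S \<Longrightarrow>
    x - y - (x' - y') \<in> complex_vector.span S"
  using complex_vector.span_diff[of "x - x'" S "y - y'"] by (simp add: algebra_simps)

lemma mod_span_uminus:
  "x - x' \<in> complex_vector.span S \<Longrightarrow> - x - - x' \<in> complex_vector.span S"
  using complex_vector.span_neg[of "x - x'" S] by (simp add: algebra_simps)

lemma mod_span_scale:
  "x - x' \<in> complex_vector.span S \<Longrightarrow> c *\<^sub>C x - c *\<^sub>C x' \<in> complex_vector.span S"
  using complex_vector.span_scale[of "x - x'" S c]
  by (simp add: complex_vector.scale_right_diff_distrib)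

instantiation tensor :: (complex_vector, complex_vector) complex_vector
begin

lift_definition zero_tensor :: "('a, 'b) tensor" is 0 .
lift_definition plus_tensor :: "('a, 'b) tensor \<Rightarrow> ('a, 'b) tensor \<Rightarrow> ('a, 'b) tensor"
  is "(+)" by (rule mod_span_add)
lift_definition minus_tensor :: "('a, 'b) tensor \<Rightarrow> ('a, 'b) tensor \<Rightarrow> ('a, 'b) tensor"
  is "(-)" by (rule mod_span_diff)
lift_definition uminus_tensor :: "('a, 'b) tensor \<Rightarrow> ('a, 'b) tensor"
  is uminus by (rule mod_span_uminus)
lift_definition scaleC_tensor :: "complex \<Rightarrow> ('a, 'b) tensor \<Rightarrow> ('a, 'b) tensor"
  is scaleC by (rule mod_span_scale)

instance
  by standard (transfer; simp add: scaleC_add_right scaleC_add_left scaleC_scaleC scaleC_one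
      complex_vector.span_zero algebra_simps)+

end

lift_definition tensor :: "'a::complex_vector \<Rightarrow> 'b::complex_vector \<Rightarrow> ('a, 'b) tensor"
    (infixl "\<otimes>" 70)
  is "\<lambda>a b. Poly_Mapping.single (a, b) 1" .

lemma tensor_add_left: "(a + a') \<otimes> b = a \<otimes> b + a' \<otimes> b"
  by transfer (intro complex_vector.span_base tensor_relators.add_left)

lemma tensor_add_right: "a \<otimes> (b + b') = a \<otimes> b + a \<otimes> b'"
  by transfer (intro complex_vector.span_base tensor_relators.add_right)

lemma tensor_scale_left: "(c *\<^sub>C a) \<otimes> b = c *\<^sub>C (a \<otimes> b)"
  by transfer (intro complex_vector.span_base tensor_relators.scale_left)

lemma tensor_scale_right: "a \<otimes> (c *\<^sub>C b) = c *\<^sub>C (a \<otimes> b)"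
  by transfer (intro complex_vector.span_base tensor_relators.scale_right)

lemma cbilinear_tensor: "cbilinear (\<otimes>)"
  by (rule cbilinearI)
    (simp_all add: tensor_add_left tensor_add_right tensor_scale_left tensor_scale_right)

lemma tensor_induct [case_names tensor add]:
  assumes tens: "\<And>a b. P (a \<otimes> b)" and add: "\<And>x y. P x \<Longrightarrow> P y \<Longrightarrow> P (x + y)"
  shows "P t"
proof (induction t rule: tensor.abs_induct)
  case (1 p)
  have zero: "P 0"
    using tens[of "0::'a" "0::'b"] tensor_scale_left[of 0 "0::'a" "0::'b"] by simp
  have single: "abs_tensor (Poly_Mapping.single k c) = (c *\<^sub>C fst k) \<otimes> snd k" for k c
  proof -
    have "c *\<^sub>C Poly_Mapping.single k (1::complex) = Poly_Mapping.single k c"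
      by (rule poly_mapping_eqI) (simp add: lookup_single when_def)
    then show ?thesis
      using tensor_scale_left[of c "fst k" "snd k"]
      by (simp add: tensor.abs_eq scaleC_tensor.abs_eq)
  qed
  show "P (abs_tensor p)"
  proof (induction p rule: update_induct)
    case const
    then show ?case using zero by (simp add: zero_tensor.abs_eq)
  next
    case (update f a b)
    have "Poly_Mapping.update a b f = f + Poly_Mapping.single a b"
      using update
      by (intro poly_mapping_eqI) (auto simp: lookup_update lookup_add lookup_single when_def in_keys_iff)
    then have "abs_tensor (Poly_Mapping.update a b f) = abs_tensor f + abs_tensor (Poly_Mapping.single a b)"
      by (simp add: plus_tensor.abs_eq)
    then show ?case using update single tens add by metis
  qed
qed

text \<open>The linear map out of a tensor product induced by a bilinear map (unspecified if the
  argument is not bilinear).\<close>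

definition tensor_lift ::
    "('a::complex_vector \<Rightarrow> 'b::complex_vector \<Rightarrow> 'c::complex_vector) \<Rightarrow> ('a, 'b) tensor \<Rightarrow> 'c"
  where "tensor_lift f = (THE g. clinear g \<and> (\<forall>a b. g (a \<otimes> b) = f a b))"

lemma tensor_lift_ex1:
  assumes f: "cbilinear f"
  shows "\<exists>!g. clinear g \<and> (\<forall>a b. g (a \<otimes> b) = f a b)"
proof -
  define F where "F p = (\<Sum>k\<in>Poly_Mapping.keys p. Poly_Mapping.lookup p k *\<^sub>C f (fst k) (snd k))" for p
  have F_add: "F (p + q) = F p + F q" for p q
    unfolding F_def by (rule setsum_keys_plus_distrib) (simp_all add: scaleC_add_left)
  have F_scale: "F (c *\<^sub>C p) = c *\<^sub>C F p" for c p
  proof -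
    have "F (c *\<^sub>C p) = (\<Sum>k\<in>Poly_Mapping.keys p. Poly_Mapping.lookup (c *\<^sub>C p) k *\<^sub>C f (fst k) (snd k))"
      unfolding F_def by (rule sum.mono_neutral_left) (auto simp: in_keys_iff)
    then show ?thesis
      by (simp add: F_def complex_vector.scale_sum_right)
  qed
  have linF: "clinear F" by (rule clinearI) (fact F_add F_scale)+
  have F_single: "F (Poly_Mapping.single (a, b) 1) = f a b" for a b
    by (simp add: F_def)
  have F_rel: "F p = 0" if "p \<in> tensor_relators" for p
    using that
    by cases (simp_all add: complex_vector.linear_diff[OF linF] F_add F_single F_scale cbilinearD[OF f])
  have F_span: "F p = 0" if "p \<in> complex_vector.span tensor_relators" for p
    using that
  proof (induction rule: complex_vector.span_induct)
    case base show ?case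
      by (auto simp: complex_vector.subspace_def F_add F_scale complex_vector.linear_0[OF linF])
  next
    case (step x) then show ?case by (rule F_rel)
  qed
  define g where "g t = F (rep_tensor t)" for t
  have g_abs: "g (abs_tensor p) = F p" for p
  proof -
    have "rep_tensor (abs_tensor p) - p \<in> complex_vector.span tensor_relators"
      using Quotient3_rep_abs[OF Quotient3_tensor, of p]
      by (simp add: complex_vector.span_zero)
    from F_span[OF this] show ?thesis
      by (simp add: g_def complex_vector.linear_diff[OF linF])
  qed
  show ?thesis
  proof (rule ex1I[of _ g])
    have "g (x + y) = g x + g y" for x y
      by (induction x rule: tensor.abs_induct, induction y rule: tensor.abs_induct)
        (simp add: plus_tensor.abs_eq g_abs F_add)
    moreover have "g (c *\<^sub>C x) = c *\<^sub>C g x" for c x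
      by (induction x rule: tensor.abs_induct) (simp add: scaleC_tensor.abs_eq g_abs F_scale)
    ultimately show "clinear g \<and> (\<forall>a b. g (a \<otimes> b) = f a b)"
      by (auto intro: clinearI simp: tensor.abs_eq g_abs F_single)
    fix h assume h: "clinear h \<and> (\<forall>a b. h (a \<otimes> b) = f a b)"
    show "h = g"
    proof
      fix t show "h t = g t"
        by (induction t rule: tensor_induct)
          (use h \<open>clinear g \<and> (\<forall>a b. g (a \<otimes> b) = f a b)\<close> in \<open>auto simp: clinear_add\<close>)
    qed
  qed
qed

lemma
  assumes "cbilinear f"
  shows clinear_tensor_lift: "clinear (tensor_lift f)"
    and tensor_lift_tensor: "tensor_lift f (a \<otimes> b) = f a b"
  using theI'[OF tensor_lift_ex1[OF assms]] by (auto simp: tensor_lift_def)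

lemmas tensor_lift_add = clinear_add[OF clinear_tensor_lift]
lemmas tensor_lift_scale = clinear_scale[OF clinear_tensor_lift]

lemma tensor_lift_unique:
  assumes "cbilinear f" "clinear g" "\<And>a b. g (a \<otimes> b) = f a b"
  shows "tensor_lift f = g"
  using tensor_lift_ex1[OF assms(1)] assms clinear_tensor_lift tensor_lift_tensor by metis

lemma tensor_lift_fun_add:
  assumes "cbilinear f" "cbilinear g"
  shows "tensor_lift (\<lambda>a b. f a b + g a b) t = tensor_lift f t + tensor_lift g t"
proof -
  have "tensor_lift (\<lambda>a b. f a b + g a b) = (\<lambda>t. tensor_lift f t + tensor_lift g t)"
    by (rule tensor_lift_unique; (rule cbilinearI clinearI)?)
      (simp_all add: assms cbilinearD tensor_lift_add tensor_lift_scale tensor_lift_tensor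
        scaleC_add_right)
  then show ?thesis by simp
qed

lemma tensor_lift_fun_scale:
  assumes "cbilinear f"
  shows "tensor_lift (\<lambda>a b. c *\<^sub>C f a b) t = c *\<^sub>C tensor_lift f t"
proof -
  have "tensor_lift (\<lambda>a b. c *\<^sub>C f a b) = (\<lambda>t. c *\<^sub>C tensor_lift f t)"
    by (rule tensor_lift_unique; (rule cbilinearI clinearI)?)
      (simp_all add: assms cbilinearD tensor_lift_add tensor_lift_scale tensor_lift_tensor
        scaleC_add_right scaleC_scaleC mult.commute)
  then show ?thesis by simp
qed

instantiation tensor :: (complex_algebra_1, complex_algebra_1) complex_algebra_1
begin

definition one_tensor :: "('a, 'b) tensor"
  where "one_tensor = 1 \<otimes> 1"

definition times_tensor :: "('a, 'b) tensor \<Rightarrow> ('a, 'b) tensor \<Rightarrow> ('a, 'b) tensor"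
  where "s * t = tensor_lift (\<lambda>a b. tensor_lift (\<lambda>a' b'. (a * a') \<otimes> (b * b')) t) s"

lemma tensor_mult_inner:
  "cbilinear (\<lambda>a' b'. ((a::'a) * a') \<otimes> ((b::'b) * b'))"
  by (rule cbilinearI) (simp_all add: distrib_left cbilinearD[OF cbilinear_tensor])

lemma tensor_mult_outer:
  fixes t :: "('a, 'b) tensor"
  shows "cbilinear (\<lambda>a b. tensor_lift (\<lambda>a' b'. (a * a') \<otimes> (b * b')) t)"
  by (rule cbilinearI)
    (simp_all add: distrib_right tensor_add_left tensor_add_right tensor_scale_left
      tensor_scale_right tensor_lift_fun_add[OF tensor_mult_inner tensor_mult_inner]
      tensor_lift_fun_scale[OF tensor_mult_inner])

lemma tensor_mult: "(a \<otimes> b) * (a' \<otimes> b') = (a * a') \<otimes> (b * b')"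
  for a a' :: 'a and b b' :: 'b
  unfolding times_tensor_def tensor_lift_tensor[OF tensor_mult_outer]
  by (rule tensor_lift_tensor[OF tensor_mult_inner])

instance
proof
  fix x y z :: "('a, 'b) tensor" and c :: complex
  show distr: "(x + y) * z = x * z + y * z" for x y z :: "('a, 'b) tensor"
    by (simp add: times_tensor_def tensor_lift_add[OF tensor_mult_outer])
  show distl: "x * (y + z) = x * y + x * z" for x y z :: "('a, 'b) tensor"
    by (simp add: times_tensor_def tensor_lift_add[OF tensor_mult_inner]
        tensor_lift_fun_add[OF tensor_mult_outer tensor_mult_outer])
  have scl: "c *\<^sub>C x * y = c *\<^sub>C (x * y)" for x y :: "('a, 'b) tensor"
    by (simp add: times_tensor_def tensor_lift_scale[OF tensor_mult_outer])
  then show "c *\<^sub>C x * y = c *\<^sub>C (x * y)" .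
  show "x * c *\<^sub>C y = c *\<^sub>C (x * y)"
    by (simp add: times_tensor_def tensor_lift_scale[OF tensor_mult_inner]
        tensor_lift_fun_scale[OF tensor_mult_outer])
  show "1 * x = x"
    by (induction x rule: tensor_induct) (simp_all add: distl one_tensor_def tensor_mult)
  show "x * 1 = x"
    by (induction x rule: tensor_induct) (simp_all add: distr one_tensor_def tensor_mult)
  have 1: "(a \<otimes> b * (a' \<otimes> b')) * z = a \<otimes> b * (a' \<otimes> b' * z)" for a a' b b' and z :: "('a, 'b) tensor"
    by (induction z rule: tensor_induct) (simp_all add: distl tensor_mult mult.assoc)
  have 2: "(a \<otimes> b * y) * z = a \<otimes> b * (y * z)" for a b and y z :: "('a, 'b) tensor"
    by (induction y rule: tensor_induct) (simp_all add: distl distr 1)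
  show "x * y * z = x * (y * z)"
    by (induction x rule: tensor_induct) (simp_all add: distl distr 2)
  obtain f :: "'a \<Rightarrow> complex" where f: "clinear f" "f 1 = 1"
    using exists_functional[of "1::'a"] by auto
  obtain g :: "'b \<Rightarrow> complex" where g: "clinear g" "g 1 = 1"
    using exists_functional[of "1::'b"] by auto
  have bil: "cbilinear (\<lambda>a b. f a * g b)"
    by (rule cbilinearI) (use f g in \<open>simp_all add: clinear_add clinear_scale algebra_simps\<close>)
  have "tensor_lift (\<lambda>a b. f a * g b) 1 \<noteq> tensor_lift (\<lambda>a b. f a * g b) 0"
    using complex_vector.linear_0[OF clinear_tensor_lift[OF bil]]
    by (simp add: one_tensor_def tensor_lift_tensor[OF bil] f g)
  then show "(0::('a, 'b) tensor) \<noteq> 1" by metis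
qed

end

section \<open>Symmetric algebras\<close>

text \<open>\<open>S(V)\<close> is presented as the free commutative algebra on the underlying set of \<open>V\<close>, i.e. the
  polynomial ring with one variable for each vector, modulo the ideal forcing the inclusion of
  variables to be linear.\<close>

definition sym_var :: "'v \<Rightarrow> ('v \<Rightarrow>\<^sub>0 nat) \<Rightarrow>\<^sub>0 complex"
  where "sym_var v = Poly_Mapping.single (Poly_Mapping.single v 1) 1"

definition sym_relators :: "(('v::complex_vector \<Rightarrow>\<^sub>0 nat) \<Rightarrow>\<^sub>0 complex) set"
  where "sym_relators =
    {sym_var (u + v) - sym_var u - sym_var v | u v. True} \<union>
    {sym_var (c *\<^sub>C u) - c *\<^sub>C sym_var u | c u. True}"

global_interpretation ring_module: module "(*) :: 'r \<Rightarrow> 'r \<Rightarrow> 'r::comm_ring_1"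
  by unfold_locales (simp_all add: algebra_simps)

abbreviation ideal_generated_by :: "'r::comm_ring_1 set \<Rightarrow> 'r set"
  where "ideal_generated_by \<equiv> ring_module.span"

lemma equivp_mod_ideal: "equivp (\<lambda>x y. x - y \<in> ideal_generated_by S)"
proof (rule equivpI)
  show "reflp (\<lambda>x y. x - y \<in> ideal_generated_by S)"
    by (simp add: reflp_def ring_module.span_zero)
  show "symp (\<lambda>x y. x - y \<in> ideal_generated_by S)"
    using ring_module.span_neg by (force simp: symp_def)
  show "transp (\<lambda>x y. x - y \<in> ideal_generated_by S)"
    using ring_module.span_add by (force simp: transp_def)
qed

quotient_type (overloaded) 'v sym_algebra =
    "(('v::complex_vector) \<Rightarrow>\<^sub>0 nat) \<Rightarrow>\<^sub>0 complex" /
    "\<lambda>x y. x - y \<in> ideal_generated_by sym_relators"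
  by (rule equivp_mod_ideal)

lemma scaleC_poly_conv_mult: "c *\<^sub>C p = Poly_Mapping.single 0 c * p"
  for p :: "'m::monoid_add \<Rightarrow>\<^sub>0 complex"
proof -
  have "c *\<^sub>C p = Poly_Mapping.map ((*) c) p"
    by (rule poly_mapping_eqI) (simp add: map.rep_eq when_def)
  then show ?thesis by (simp add: mult_map_scale_conv_mult)
qed

lemma scaleC_poly_mult_left: "c *\<^sub>C p * q = c *\<^sub>C (p * q)"
  for p q :: "'m::monoid_add \<Rightarrow>\<^sub>0 complex"
  by (simp add: scaleC_poly_conv_mult mult.assoc)

lemma scaleC_poly_mult_right: "p * c *\<^sub>C q = c *\<^sub>C (p * q)"
  for p q :: "'m::comm_monoid_add \<Rightarrow>\<^sub>0 complex"
  by (metis mult.commute scaleC_poly_mult_left)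

lemma lookup_mult_zero: "Poly_Mapping.lookup (p * q) 0 = Poly_Mapping.lookup p 0 * Poly_Mapping.lookup q 0"
  for p q :: "('v \<Rightarrow>\<^sub>0 nat) \<Rightarrow>\<^sub>0 complex"
proof -
  have *: "(0 = l + m) \<longleftrightarrow> l = 0 \<and> m = 0" for l m :: "'v \<Rightarrow>\<^sub>0 nat"
    by (auto simp: poly_mapping_eq_iff fun_eq_iff lookup_add)
  have "(\<Sum>m. Poly_Mapping.lookup q m when 0 = l + m) = (Poly_Mapping.lookup q 0 when l = 0)" for l
    by (cases "l = 0") (simp_all add: *)
  then show ?thesis
    by (simp add: lookup_mult mult_when)
qed

lemma sym_ideal_lookup_zero:
  assumes "p \<in> ideal_generated_by sym_relators"
  shows "Poly_Mapping.lookup p 0 = 0"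
  using assms
proof (induction rule: ring_module.span_induct)
  case base
  then show ?case by (auto simp: ring_module.subspace_def lookup_add lookup_mult_zero)
next
  case (step x)
  have "Poly_Mapping.single v (1::nat) \<noteq> 0" for v :: 'a
    by (metis lookup_single_eq lookup_zero zero_neq_one)
  then have "Poly_Mapping.lookup (sym_var v) 0 = 0" for v :: 'a
    by (simp add: sym_var_def lookup_single when_def)
  with step show ?case by (auto simp: sym_relators_def lookup_minus)
qed

instantiation sym_algebra :: (complex_vector) "{comm_ring_1, complex_algebra_1}"
begin

lift_definition zero_sym_algebra :: "'a sym_algebra" is 0 .
lift_definition one_sym_algebra :: "'a sym_algebra" is 1 .
lift_definition plus_sym_algebra :: "'a sym_algebra \<Rightarrow> 'a sym_algebra \<Rightarrow> 'a sym_algebra"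
  is "(+)"
  subgoal for x x' y y' using ring_module.span_add[of "x - x'" _ "y - y'"] by (simp add: algebra_simps)
  done
lift_definition minus_sym_algebra :: "'a sym_algebra \<Rightarrow> 'a sym_algebra \<Rightarrow> 'a sym_algebra"
  is "(-)"
  subgoal for x x' y y' using ring_module.span_diff[of "x - x'" _ "y - y'"] by (simp add: algebra_simps)
  done
lift_definition uminus_sym_algebra :: "'a sym_algebra \<Rightarrow> 'a sym_algebra"
  is uminus
  subgoal for x x' using ring_module.span_neg[of "x - x'"] by (simp add: algebra_simps)
  done
lift_definition times_sym_algebra :: "'a sym_algebra \<Rightarrow> 'a sym_algebra \<Rightarrow> 'a sym_algebra"
  is "(*)"
  subgoal for x x' y y'
    using ring_module.span_add[OF ring_module.span_scale[of "x - x'" _ y]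
        ring_module.span_scale[of "y - y'" _ x']]
    by (simp add: algebra_simps)
  done
lift_definition scaleC_sym_algebra :: "complex \<Rightarrow> 'a sym_algebra \<Rightarrow> 'a sym_algebra"
  is scaleC
  subgoal for c x x'
    using ring_module.span_scale[of "x - x'" _ "Poly_Mapping.single 0 c"]
    by (simp add: algebra_simps scaleC_poly_conv_mult)
  done

instance
proof
  have False if "0 - 1 \<in> ideal_generated_by (sym_relators :: (('a \<Rightarrow>\<^sub>0 nat) \<Rightarrow>\<^sub>0 complex) set)"
    using sym_ideal_lookup_zero[OF that] by (simp add: lookup_minus)
  then show "(0::'a sym_algebra) \<noteq> 1"
    by transfer auto
  have eq: "x - y \<in> ideal_generated_by sym_relators" if "x = y"
    for x y :: "('a \<Rightarrow>\<^sub>0 nat) \<Rightarrow>\<^sub>0 complex"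
    using that by (simp add: ring_module.span_zero)
  fix a b c :: "'a sym_algebra" and r s :: complex
  show "a + b + c = a + (b + c)" by transfer (rule eq, rule add.assoc)
  show "a + b = b + a" by transfer (rule eq, rule add.commute)
  show "0 + a = a" by transfer (rule eq, rule add_0)
  show "- a + a = 0" by transfer (rule eq, rule left_minus)
  show "a - b = a + - b" by transfer (rule eq, rule diff_conv_add_uminus)
  show "a * b * c = a * (b * c)" by transfer (rule eq, rule mult.assoc)
  show "a * b = b * a" by transfer (rule eq, rule mult.commute)
  show "1 * a = a" by transfer (rule eq, rule mult_1)
  show "a * 1 = a" by transfer (rule eq, rule mult_1_right)
  show "a * (b + c) = a * b + a * c" by transfer (rule eq, rule distrib_left)
  show "(a + b) * c = a * c + b * c" by transfer (rule eq, rule distrib_right)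
  show "r *\<^sub>C (a + b) = r *\<^sub>C a + r *\<^sub>C b" by transfer (rule eq, rule scaleC_add_right)
  show "(r + s) *\<^sub>C a = r *\<^sub>C a + s *\<^sub>C a" by transfer (rule eq, rule scaleC_add_left)
  show "r *\<^sub>C s *\<^sub>C a = (r * s) *\<^sub>C a" by transfer (rule eq, rule scaleC_scaleC)
  show "1 *\<^sub>C a = a" by transfer (rule eq, rule scaleC_one)
  show "r *\<^sub>C a * b = r *\<^sub>C (a * b)" by transfer (rule eq, rule scaleC_poly_mult_left)
  show "a * r *\<^sub>C b = r *\<^sub>C (a * b)" by transfer (rule eq, rule scaleC_poly_mult_right)
qed

end

lift_definition sym_incl :: "'v::complex_vector \<Rightarrow> 'v sym_algebra" is sym_var .

lemma clinear_sym_incl: "clinear sym_incl"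
proof (rule clinearI)
  show "sym_incl (u + v) = sym_incl u + sym_incl v" for u v :: 'a
    by transfer
      (rule ring_module.span_base, unfold diff_diff_eq[symmetric], auto simp: sym_relators_def)
  show "sym_incl (c *\<^sub>C u) = c *\<^sub>C sym_incl u" for c and u :: 'a
    by transfer (rule ring_module.span_base, auto simp: sym_relators_def)
qed

section \<open>Double Poisson brackets\<close>

text \<open>A bracket is given as a map on \<open>A \<otimes> A\<close>, so its value on a pair \<open>a, b\<close> is \<open>db (a \<otimes> b)\<close>.\<close>

definition tensor_flip :: "('a::complex_vector, 'b::complex_vector) tensor \<Rightarrow> ('b, 'a) tensor"
  where "tensor_flip = tensor_lift (\<lambda>u v. v \<otimes> u)"

definition outer_action ::
    "'a::complex_algebra_1 \<Rightarrow> ('a, 'a) tensor \<Rightarrow> 'a \<Rightarrow> ('a, 'a) tensor"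
  where "outer_action a t c = tensor_lift (\<lambda>u v. (a * u) \<otimes> (v * c)) t"

text \<open>\<open>A \<otimes> A \<otimes> A\<close> is represented as \<open>(A \<otimes> A) \<otimes> A\<close>; the rotation sends \<open>a1 \<otimes> a2 \<otimes> a3\<close> to
  \<open>a3 \<otimes> a1 \<otimes> a2\<close>.\<close>

definition tensor_rot :: "(('a::complex_vector, 'a) tensor, 'a) tensor \<Rightarrow> (('a, 'a) tensor, 'a) tensor"
  where "tensor_rot = tensor_lift (\<lambda>t a3. tensor_lift (\<lambda>a1 a2. a3 \<otimes> a1 \<otimes> a2) t)"

definition bracket_left ::
    "(('a::complex_algebra_1, 'a) tensor \<Rightarrow> ('a, 'a) tensor) \<Rightarrow>
      'a \<Rightarrow> ('a, 'a) tensor \<Rightarrow> (('a, 'a) tensor, 'a) tensor"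
  where "bracket_left db a = tensor_lift (\<lambda>u v. db (a \<otimes> u) \<otimes> v)"

definition double_poisson_bracket ::
    "(('a::complex_algebra_1, 'a) tensor \<Rightarrow> ('a, 'a) tensor) \<Rightarrow> bool"
  where "double_poisson_bracket db \<longleftrightarrow>
    clinear db \<and>
    (\<forall>a b. db (a \<otimes> b) = - tensor_flip (db (b \<otimes> a))) \<and>
    (\<forall>a b c. db (a \<otimes> (b * c)) = outer_action b (db (a \<otimes> c)) 1 + outer_action 1 (db (a \<otimes> b)) c) \<and>
    (\<forall>a b c. bracket_left db a (db (b \<otimes> c)) +
      tensor_rot (bracket_left db b (db (c \<otimes> a))) +
      inv tensor_rot (bracket_left db c (db (a \<otimes> b))) = 0)"

definition mult_map :: "('a::complex_algebra_1, 'a) tensor \<Rightarrow> 'a"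
  where "mult_map = tensor_lift (*)"

definition bracket_L ::
    "(('a::complex_algebra_1, 'a) tensor \<Rightarrow> ('a, 'a) tensor) \<Rightarrow> 'a \<Rightarrow> 'a \<Rightarrow> 'a"
  where "bracket_L db a b = mult_map (db (a \<otimes> b))"

section \<open>The necklace Lie algebra, the necklace algebra and the trace algebra\<close>

quotient_type (overloaded) 'a necklace_lie = "'a::complex_algebra_1" /
    "\<lambda>x y. x - y \<in> complex_vector.span {a * b - b * a | a b. True}"
  by (rule equivp_mod_span)

instantiation necklace_lie :: (complex_algebra_1) complex_vector
begin

lift_definition zero_necklace_lie :: "'a necklace_lie" is 0 .
lift_definition plus_necklace_lie :: "'a necklace_lie \<Rightarrow> 'a necklace_lie \<Rightarrow> 'a necklace_lie"
  is "(+)" by (rule mod_span_add)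
lift_definition minus_necklace_lie :: "'a necklace_lie \<Rightarrow> 'a necklace_lie \<Rightarrow> 'a necklace_lie"
  is "(-)" by (rule mod_span_diff)
lift_definition uminus_necklace_lie :: "'a necklace_lie \<Rightarrow> 'a necklace_lie"
  is uminus by (rule mod_span_uminus)
lift_definition scaleC_necklace_lie :: "complex \<Rightarrow> 'a necklace_lie \<Rightarrow> 'a necklace_lie"
  is scaleC by (rule mod_span_scale)

instance
  by standard (transfer; simp add: scaleC_add_right scaleC_add_left scaleC_scaleC scaleC_one
      complex_vector.span_zero algebra_simps)+

end

lift_definition necklace_proj :: "'a::complex_algebra_1 \<Rightarrow> 'a necklace_lie" is "\<lambda>a. a" .

type_synonym 'a necklace_algebra = "'a necklace_lie sym_algebra"
type_synonym 'a trace_algebra = "('a necklace_algebra, 'a) tensor"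

text \<open>The definite descriptions below denote the intended objects whenever the bracket is a double
  Poisson bracket: \<open>bracket_L db\<close> then vanishes on commutators in its first argument and is a
  derivation in its second, so it descends to \<open>A/[A,A]\<close>, and derivations are determined by their
  values on algebra generators.\<close>

definition necklace_bracket ::
    "(('a::complex_algebra_1, 'a) tensor \<Rightarrow> ('a, 'a) tensor) \<Rightarrow>
      'a necklace_lie \<Rightarrow> 'a necklace_lie \<Rightarrow> 'a necklace_lie"
  where "necklace_bracket db =
    (THE br. \<forall>a b. br (necklace_proj a) (necklace_proj b) = necklace_proj (bracket_L db a b))"

text \<open>The Lie-Poisson bracket on \<open>S(V)\<close>: the unique biderivation extending a bilinear bracket
  on \<open>V\<close>.\<close>

definition lie_poisson_bracket ::
    "('v::complex_vector \<Rightarrow> 'v \<Rightarrow> 'v) \<Rightarrow> 'v sym_algebra \<Rightarrow> 'v sym_algebra \<Rightarrow> 'v sym_algebra"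
  where "lie_poisson_bracket br =
    (THE P. (\<forall>x. derivation (P x)) \<and> (\<forall>y. derivation (\<lambda>x. P x y)) \<and>
      (\<forall>u v. P (sym_incl u) (sym_incl v) = sym_incl (br u v)))"

definition necklace_poisson_bracket ::
    "(('a::complex_algebra_1, 'a) tensor \<Rightarrow> ('a, 'a) tensor) \<Rightarrow>
      'a necklace_algebra \<Rightarrow> 'a necklace_algebra \<Rightarrow> 'a necklace_algebra"
  where "necklace_poisson_bracket db = lie_poisson_bracket (necklace_bracket db)"

text \<open>The identification of \<open>N\<close> with the subalgebra \<open>N \<otimes> 1\<close> of \<open>T = N \<otimes> A\<close>.\<close>

definition necklace_in_trace :: "'a::complex_algebra_1 necklace_algebra \<Rightarrow> 'a trace_algebra"
  where "necklace_in_trace z = z \<otimes> 1"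

lemma inj_necklace_in_trace: "inj (necklace_in_trace :: 'a::complex_algebra_1 necklace_algebra \<Rightarrow> _)"
proof -
  obtain f :: "'a \<Rightarrow> complex" where f: "clinear f" "f 1 = 1"
    using exists_functional[of "1::'a"] by auto
  have bil: "cbilinear (\<lambda>(z::'a necklace_algebra) a. f a *\<^sub>C z)"
    by (rule cbilinearI)
      (use f in \<open>simp_all add: clinear_add clinear_scale scaleC_add_left scaleC_add_right
        scaleC_scaleC mult.commute\<close>)
  show ?thesis
    by (rule inj_on_inverseI[where g = "tensor_lift (\<lambda>(z::'a necklace_algebra) a. f a *\<^sub>C z)"])
      (simp add: necklace_in_trace_def tensor_lift_tensor[OF bil] f scaleC_one)
qed

text \<open>In the last clause \<open>a\<close> runs over all lifts of elements of \<open>A/[A,A]\<close>.\<close>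

definition trace_hamiltonian ::
    "(('a::complex_algebra_1, 'a) tensor \<Rightarrow> ('a, 'a) tensor) \<Rightarrow>
      'a necklace_algebra \<Rightarrow> 'a trace_algebra \<Rightarrow> 'a trace_algebra"
  where "trace_hamiltonian db =
    (THE H. (\<forall>t. clinear (\<lambda>z. H z t)) \<and>
      (\<forall>z z' t. H (z * z') t = (z \<otimes> 1) * H z' t + (z' \<otimes> 1) * H z t) \<and>
      (\<forall>w. derivation (H (sym_incl w))) \<and>
      (\<forall>w z. H (sym_incl w) (z \<otimes> 1) = necklace_poisson_bracket db (sym_incl w) z \<otimes> 1) \<and>
      (\<forall>a b. H (sym_incl (necklace_proj a)) (1 \<otimes> b) = 1 \<otimes> bracket_L db a b))"

section \<open>Formal Poisson orders\<close>

definition poisson_bracket_on :: "'b::complex_algebra_1 set \<Rightarrow> ('b \<Rightarrow> 'b \<Rightarrow> 'b) \<Rightarrow> bool"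
  where "poisson_bracket_on Z P \<longleftrightarrow>
    (\<forall>x\<in>Z. \<forall>y\<in>Z. P x y \<in> Z) \<and>
    (\<forall>x\<in>Z. \<forall>y\<in>Z. \<forall>z\<in>Z. P x (y + z) = P x y + P x z) \<and>
    (\<forall>c. \<forall>x\<in>Z. \<forall>y\<in>Z. P x (c *\<^sub>C y) = c *\<^sub>C P x y) \<and>
    (\<forall>x\<in>Z. \<forall>y\<in>Z. P x y = - P y x) \<and>
    (\<forall>x\<in>Z. \<forall>y\<in>Z. \<forall>z\<in>Z. P x (P y z) + P y (P z x) + P z (P x y) = 0) \<and>
    (\<forall>x\<in>Z. \<forall>y\<in>Z. \<forall>z\<in>Z. P x (y * z) = P x y * z + y * P x z)"

text \<open>\<open>B\<close> is the whole type; only the values \<open>H z\<close> for \<open>z \<in> Z\<close> are relevant.\<close>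

definition formal_poisson_order ::
    "'b::complex_algebra_1 set \<Rightarrow> ('b \<Rightarrow> 'b \<Rightarrow> 'b) \<Rightarrow> bool"
  where "formal_poisson_order Z H \<longleftrightarrow>
    subalgebra Z \<and> (\<forall>z\<in>Z. \<forall>b. z * b = b * z) \<and>
    (\<forall>z\<in>Z. derivation (H z)) \<and>
    (\<forall>z\<in>Z. \<forall>z'\<in>Z. \<forall>b. H (z + z') b = H z b + H z' b) \<and>
    (\<forall>c. \<forall>z\<in>Z. \<forall>b. H (c *\<^sub>C z) b = c *\<^sub>C H z b) \<and>
    (\<forall>z\<in>Z. \<forall>z'\<in>Z. \<forall>b. H (z * z') b = z * H z' b + z' * H z b) \<and>
    poisson_bracket_on Z (\<lambda>z z'. H z z')"

end

theory Submission
  imports Defs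
begin

text \<open>For fixed \<open>a\<close>, \<open>{a, -}\<^sub>L\<close> is a derivation of \<open>A\<close>, and multiplying out the double Jacobi
  identity shows that \<open>{-, -}\<^sub>L\<close> satisfies the Jacobi identity in Leibniz form, so that \<open>A/[A,A]\<close>
  is a Lie algebra. A linear map from \<open>V\<close> to an \<open>S(V)\<close>-module extends uniquely to a derivation
  on \<open>S(V)\<close>. Applied twice this gives the Lie-Poisson bracket, whose skew symmetry and Jacobi
  identity are identities between derivations in each argument, hence need checking on generators only; applied to
  \<open>w \<mapsto> {w, -} \<otimes> 1 + 1 \<otimes> {w, -}\<^sub>L\<close> it gives \<open>H\<close>. By uniqueness again,
  \<open>H(z)(z' \<otimes> 1) = {z, z'} \<otimes> 1\<close>, which reduces the Poisson axioms to those on \<open>S(A/[A,A])\<close>.\<close>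

section \<open>Derivations on symmetric algebras\<close>

lemma derivationD:
  assumes "derivation D"
  shows "D (x + y) = D x + D y" "D (c *\<^sub>C x) = c *\<^sub>C D x" "D (x * y) = D x * y + x * D y"
  using assms by (auto simp: derivation_def clinear_add clinear_scale)

lemma clinearD:
  assumes "clinear f"
  shows "f (x + y) = f x + f y" "f (x - y) = f x - f y" "f (- x) = - f x" "f 0 = 0"
    "f (c *\<^sub>C x) = c *\<^sub>C f x"
  using assms
  by (simp_all add: clinear_add clinear_scale complex_vector.linear_diff complex_vector.linear_neg
      complex_vector.linear_0)

section \<open>Free complex vector spaces: induction and linear extension from a basis\<close>

lemma poly_mapping_linear_induct [case_names single add]:
  assumes single: "\<And>k c. P (c *\<^sub>C Poly_Mapping.single k (1::complex))"
    and add: "\<And>p q. P p \<Longrightarrow> P q \<Longrightarrow> P (p + q)"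
  shows "P p"
proof (induction p rule: update_induct)
  case const
  show ?case using single[of 0] by simp
next
  case (update f a b)
  have "Poly_Mapping.update a b f = f + b *\<^sub>C Poly_Mapping.single a 1"
    using update
    by (intro poly_mapping_eqI)
      (auto simp: lookup_update lookup_add lookup_single when_def in_keys_iff)
  with update single add show ?case by simp
qed

lemma poly_mapping_linear_extension:
  fixes f :: "'k \<Rightarrow> 'b::complex_vector"
  shows "\<exists>F. clinear F \<and> (\<forall>k. F (Poly_Mapping.single k (1::complex)) = f k)"
proof -
  define F where "F p = (\<Sum>k\<in>Poly_Mapping.keys p. Poly_Mapping.lookup p k *\<^sub>C f k)" for p
  have "F (p + q) = F p + F q" for p q
    unfolding F_def by (rule setsum_keys_plus_distrib) (simp_all add: scaleC_add_left)
  moreover have "F (c *\<^sub>C p) = c *\<^sub>C F p" for c p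
  proof -
    have "F (c *\<^sub>C p) = (\<Sum>k\<in>Poly_Mapping.keys p. Poly_Mapping.lookup (c *\<^sub>C p) k *\<^sub>C f k)"
      unfolding F_def by (rule sum.mono_neutral_left) (auto simp: in_keys_iff)
    then show ?thesis
      by (simp add: F_def complex_vector.scale_sum_right)
  qed
  moreover have "F (Poly_Mapping.single k 1) = f k" for k
    by (simp add: F_def)
  ultimately show ?thesis
    by (intro exI[of _ F]) (simp add: clinearI)
qed

text \<open>The class in \<open>S(V)\<close> of the monomial with exponents \<open>m\<close>.
  Variables are indexed by all vectors of \<open>V\<close>, not by a basis, so these classes span
  \<open>S(V)\<close> but satisfy linear relations.\<close>

definition sym_monomial :: "('v \<Rightarrow>\<^sub>0 nat) \<Rightarrow> 'v::complex_vector sym_algebra"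
  where "sym_monomial m = abs_sym_algebra (Poly_Mapping.single m 1)"

lemma clinear_abs_sym_algebra: "clinear abs_sym_algebra"
  by (rule clinearI) (simp_all add: plus_sym_algebra.abs_eq scaleC_sym_algebra.abs_eq)

lemma abs_sym_algebra_mult: "abs_sym_algebra (p * q) = abs_sym_algebra p * abs_sym_algebra q"
  by (simp add: times_sym_algebra.abs_eq)

lemma sym_monomial_add: "sym_monomial (m + n) = sym_monomial m * sym_monomial n"
  by (simp add: sym_monomial_def times_sym_algebra.abs_eq mult_single)

lemma sym_monomial_0 [simp]: "sym_monomial 0 = 1"
  by (simp add: sym_monomial_def one_sym_algebra.abs_eq single_one)

lemma sym_monomial_single [simp]: "sym_monomial (Poly_Mapping.single v (Suc 0)) = sym_incl v"
  by (simp add: sym_monomial_def sym_incl.abs_eq sym_var_def)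

text \<open>The elements \<open>sym_incl v\<close> generate \<open>S(V)\<close> as a unital algebra:
  they give powers, powers give monomials, and every class is a linear combination of
  monomials.\<close>

lemma sym_induct [case_names one incl add scale mult]:
  assumes one: "P 1" and incl: "\<And>v. P (sym_incl v)"
    and add: "\<And>x y. P x \<Longrightarrow> P y \<Longrightarrow> P (x + y)"
    and scale: "\<And>c x. P x \<Longrightarrow> P (c *\<^sub>C x)"
    and mult: "\<And>x y. P x \<Longrightarrow> P y \<Longrightarrow> P (x * y)"
  shows "P z"
proof (induction z rule: sym_algebra.abs_induct)
  case (1 p)
  have single: "P (sym_monomial (Poly_Mapping.single v n))" for v n
  proof (induction n)
    case 0
    then show ?case by (simp add: one)
  next
    case (Suc n)
    have "Poly_Mapping.single v (Suc n) = Poly_Mapping.single v (Suc 0) + Poly_Mapping.single v n"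
      by (simp flip: single_add)
    with Suc show ?case by (simp add: sym_monomial_add incl mult)
  qed
  have monomial: "P (sym_monomial m)" for m
  proof (induction m rule: update_induct)
    case const
    then show ?case by (simp add: one)
  next
    case (update f a b)
    have "Poly_Mapping.update a b f = f + Poly_Mapping.single a b"
      using update
      by (intro poly_mapping_eqI)
        (auto simp: lookup_update lookup_add lookup_single when_def in_keys_iff)
    with update single mult show ?case by (simp add: sym_monomial_add)
  qed
  show ?case
  proof (induction p rule: poly_mapping_linear_induct)
    case (single k c)
    then show ?case
      using scale[OF monomial, of c k] by (simp add: sym_monomial_def clinearD[OF clinear_abs_sym_algebra])
  next
    case (add p q)
    then show ?case using assms(3) by (simp add: clinearD[OF clinear_abs_sym_algebra])
  qed
qed

text \<open>The target is an \<open>S(V)\<close>-module through left multiplication by the values of \<open>\<phi>\<close>.\<close>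

definition derivation_along ::
    "('b::complex_algebra_1 \<Rightarrow> 'c::complex_algebra_1) \<Rightarrow> ('b \<Rightarrow> 'c) \<Rightarrow> bool"
  where "derivation_along \<phi> D \<longleftrightarrow> clinear D \<and> (\<forall>x y. D (x * y) = \<phi> x * D y + \<phi> y * D x)"

lemma derivation_alongD:
  assumes "derivation_along \<phi> D"
  shows "D (x + y) = D x + D y" "D (c *\<^sub>C x) = c *\<^sub>C D x" "D (x * y) = \<phi> x * D y + \<phi> y * D x"
  using assms by (auto simp: derivation_along_def clinearD)

lemma derivation_alongI:
  assumes "\<And>x y. D (x + y) = D x + D y" "\<And>c x. D (c *\<^sub>C x) = c *\<^sub>C D x"
    "\<And>x y. D (x * y) = \<phi> x * D y + \<phi> y * D x"
  shows "derivation_along \<phi> D"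
  using assms by (auto simp: derivation_along_def intro: clinearI)

text \<open>Commutativity of \<open>S(V)\<close> allows both coefficients of the Leibniz rule to
  stand on the left.\<close>

lemma derivation_along_id: "derivation_along (\<lambda>x. x) D \<longleftrightarrow> derivation D"
  for D :: "'v::complex_vector sym_algebra \<Rightarrow> 'v sym_algebra"
  by (simp add: derivation_along_def derivation_def ac_simps)

text \<open>Besides the generators only the value at \<open>1\<close> matters, and the Leibniz rule
  for \<open>1 * 1\<close> together with \<open>\<phi> 1 = 1\<close> forces it to be
  \<open>0\<close>.\<close>

lemma derivation_along_sym_unique:
  assumes D: "derivation_along \<phi> D" and D': "derivation_along \<phi> D'" and \<phi>: "\<phi> 1 = 1"
    and eq: "\<And>v. D (sym_incl v) = D' (sym_incl v)"
  shows "D z = D' z"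
proof (induction z rule: sym_induct)
  case one
  have "E 1 = 0" if "derivation_along \<phi> E" for E
    using derivation_alongD(3)[OF that, of 1 1] \<phi> by simp
  from this[OF D] this[OF D'] show ?case by simp
qed (simp_all add: eq derivation_alongD[OF D] derivation_alongD[OF D'])

lemmas sym_incl_lin = clinearD[OF clinear_sym_incl]

text \<open>The product rule prescribes the values on monomials; these extend linearly to the
  polynomial ring, and linearity of \<open>K\<close> makes the result vanish on the defining ideal.
  The target may be noncommutative: coefficients from \<open>\<phi>\<close> always stay on the left
  of values of \<open>K\<close>.\<close>

lemma derivation_along_sym_extension:
  fixes K :: "'v::complex_vector \<Rightarrow> 'b::complex_algebra_1"
  assumes \<phi>: "clinear \<phi>" "\<phi> 1 = 1" "\<And>x y. \<phi> (x * y) = \<phi> x * \<phi> y"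
    and K: "clinear K"
  shows "\<exists>D. derivation_along \<phi> D \<and> (\<forall>v. D (sym_incl v) = K v)"
proof -
  note \<phi>_lin = clinearD[OF \<phi>(1)]
  \<comment> \<open>Formal differentiation of a monomial: each variable \<open>v\<close> contributes
    its exponent times the monomial with one factor \<open>v\<close> removed, times
    \<open>K v\<close>.\<close>
  define E where "E m = (\<Sum>v\<in>Poly_Mapping.keys m. of_nat (Poly_Mapping.lookup m v) *\<^sub>C
    (\<phi> (sym_monomial (m - Poly_Mapping.single v 1)) * K v))" for m :: "'v \<Rightarrow>\<^sub>0 nat"
  have E_superset: "E m = (\<Sum>v\<in>S. of_nat (Poly_Mapping.lookup m v) *\<^sub>C
      (\<phi> (sym_monomial (m - Poly_Mapping.single v 1)) * K v))"
    if "finite S" "Poly_Mapping.keys m \<subseteq> S" for m S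
    unfolding E_def using that by (intro sum.mono_neutral_left) (auto simp: in_keys_iff)
  have shift: "of_nat (Poly_Mapping.lookup m v) *\<^sub>C \<phi> (sym_monomial (m + n - Poly_Mapping.single v 1))
      = \<phi> (sym_monomial n) * of_nat (Poly_Mapping.lookup m v) *\<^sub>C
        \<phi> (sym_monomial (m - Poly_Mapping.single v 1))" for m n :: "'v \<Rightarrow>\<^sub>0 nat" and v
  \<comment> \<open>Subtraction of exponents is truncated, so removing a factor \<open>v\<close> is
    meaningful only if \<open>v\<close> occurs in \<open>m\<close>; otherwise the coefficient is
    zero and both sides vanish.\<close>
  proof (cases "Poly_Mapping.lookup m v = 0")
    case False
    then have "m + n - Poly_Mapping.single v 1 = n + (m - Poly_Mapping.single v 1)"
      by (intro poly_mapping_eqI) (auto simp: lookup_add lookup_minus lookup_single when_def)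
    then show ?thesis by (simp add: sym_monomial_add \<phi>)
  qed simp
  have E_add: "E (m + n) = \<phi> (sym_monomial m) * E n + \<phi> (sym_monomial n) * E m" for m n
  proof -
    define S where "S = Poly_Mapping.keys m \<union> Poly_Mapping.keys n"
    have S: "finite S" "Poly_Mapping.keys m \<subseteq> S" "Poly_Mapping.keys n \<subseteq> S"
      "Poly_Mapping.keys (m + n) \<subseteq> S"
      using keys_add[of m n] by (auto simp: S_def)
    have "of_nat (Poly_Mapping.lookup (m + n) v) *\<^sub>C
          (\<phi> (sym_monomial (m + n - Poly_Mapping.single v 1)) * K v) =
        \<phi> (sym_monomial m) * (of_nat (Poly_Mapping.lookup n v) *\<^sub>C
          (\<phi> (sym_monomial (n - Poly_Mapping.single v 1)) * K v)) +
        \<phi> (sym_monomial n) * (of_nat (Poly_Mapping.lookup m v) *\<^sub>C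
          (\<phi> (sym_monomial (m - Poly_Mapping.single v 1)) * K v))" for v
      using shift[of m v n, THEN arg_cong[where f = "\<lambda>x. x * K v"]]
        shift[of n v m, THEN arg_cong[where f = "\<lambda>x. x * K v"]]
      by (auto simp: lookup_add scaleC_add_left mult.assoc add.commute)
    then show ?thesis
      using S by (simp add: E_superset[of S] sum.distrib sum_distrib_left)
  qed
  obtain F where F: "clinear F" "\<And>m. F (Poly_Mapping.single m (1::complex)) = E m"
    using poly_mapping_linear_extension[of E] by blast
  note F_lin = clinearD[OF F(1)] and abs_lin = clinearD[OF clinear_abs_sym_algebra]
  have F_mult: "F (p * q) = \<phi> (abs_sym_algebra p) * F q + \<phi> (abs_sym_algebra q) * F p" for p q
  proof (induction p rule: poly_mapping_linear_induct)
    case (single m c)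
    show ?case
    proof (induction q rule: poly_mapping_linear_induct)
      case (single n d)
      have "F (Poly_Mapping.single m 1 * Poly_Mapping.single n 1) = E (m + n)"
        by (simp add: mult_single F)
      then show ?case
        by (simp add: F_lin abs_lin \<phi>_lin F E_add scaleC_poly_mult_left scaleC_poly_mult_right
            scaleC_scaleC scaleC_add_right mult.commute[of c d] flip: sym_monomial_def)
    next
      case (add p q)
      then show ?case by (simp add: F_lin abs_lin \<phi>_lin distrib_left distrib_right scaleC_add_right)
    qed
  next
    case (add p q)
    then show ?case by (simp add: F_lin abs_lin \<phi>_lin distrib_left distrib_right)
  qed
  have F_var: "F (sym_var v) = K v" for v
    using F by (simp add: sym_var_def E_def \<phi> scaleC_one)
  \<comment> \<open>Both vanishing claims are proved together: in the Leibniz rule for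
    \<open>F (r * p)\<close> one term is killed by \<open>F p = 0\<close> and the other by
    \<open>abs_sym_algebra p = 0\<close>.\<close>
  have ideal: "abs_sym_algebra p = 0 \<and> F p = 0" if "p \<in> ideal_generated_by sym_relators" for p
    using that
  proof (induction rule: ring_module.span_induct)
    case base
    show ?case
      by (auto simp: ring_module.subspace_def F_lin abs_lin \<phi>_lin F_mult abs_sym_algebra_mult)
  next
    case (step p)
    then show ?case
      by (auto simp: sym_relators_def F_lin abs_lin F_var clinearD[OF K]
          sym_incl.abs_eq[symmetric] sym_incl_lin)
  qed
  \<comment> \<open>The chosen representative does not matter, since \<open>F\<close> vanishes on
    the ideal.\<close>
  define D where "D z = F (rep_sym_algebra z)" for z
  have D_abs: "D (abs_sym_algebra p) = F p" for p
  proof -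
    have "rep_sym_algebra (abs_sym_algebra p) - p \<in> ideal_generated_by sym_relators"
      using Quotient3_rep_abs[OF Quotient3_sym_algebra, of p] by (simp add: ring_module.span_zero)
    from ideal[OF this] show ?thesis by (simp add: D_def F_lin)
  qed
  have "derivation_along \<phi> D"
  proof (rule derivation_alongI)
    show "D (x + y) = D x + D y" for x y
      by (induction x rule: sym_algebra.abs_induct, induction y rule: sym_algebra.abs_induct)
        (simp add: D_abs F_lin flip: abs_lin(1))
    show "D (c *\<^sub>C x) = c *\<^sub>C D x" for c x
      by (induction x rule: sym_algebra.abs_induct) (simp add: D_abs F_lin flip: abs_lin(5))
    show "D (x * y) = \<phi> x * D y + \<phi> y * D x" for x y
      by (induction x rule: sym_algebra.abs_induct, induction y rule: sym_algebra.abs_induct)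
        (simp add: D_abs F_mult flip: abs_sym_algebra_mult)
  qed
  moreover have "D (sym_incl v) = K v" for v
    by (simp add: sym_incl.abs_eq D_abs F_var)
  ultimately show ?thesis by blast
qed

section \<open>The bracket induced on the algebra\<close>

lemmas tensor_bilinear = tensor_add_left tensor_add_right tensor_scale_left tensor_scale_right

section \<open>Structure maps on two and three tensor factors\<close>

lemma cbilinear_flip: "cbilinear (\<lambda>u v. v \<otimes> u)"
  by (rule cbilinearI) (simp_all add: tensor_bilinear)

lemmas tensor_flip_lin = clinearD[OF clinear_tensor_lift[OF cbilinear_flip], folded tensor_flip_def]

lemma tensor_flip_tensor [simp]: "tensor_flip (u \<otimes> v) = v \<otimes> u"
  by (simp add: tensor_flip_def tensor_lift_tensor[OF cbilinear_flip])

lemma cbilinear_mult: "cbilinear ((*) :: 'a::complex_algebra_1 \<Rightarrow> _)"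
  by (rule cbilinearI) (simp_all add: distrib_left distrib_right)

lemmas mult_map_lin = clinearD[OF clinear_tensor_lift[OF cbilinear_mult], folded mult_map_def]

lemma mult_map_tensor [simp]: "mult_map (u \<otimes> v) = u * v"
  by (simp add: mult_map_def tensor_lift_tensor[OF cbilinear_mult])

lemma cbilinear_outer: "cbilinear (\<lambda>u v. (a * u) \<otimes> (v * c))" for a c :: "'a::complex_algebra_1"
  by (rule cbilinearI) (simp_all add: tensor_bilinear distrib_left distrib_right)

lemmas outer_action_lin = clinearD[OF clinear_tensor_lift[OF cbilinear_outer], folded outer_action_def]

lemma outer_action_tensor [simp]: "outer_action a (u \<otimes> v) c = (a * u) \<otimes> (v * c)"
  by (simp add: outer_action_def tensor_lift_tensor[OF cbilinear_outer])

lemma mult_map_outer_action: "mult_map (outer_action a t c) = a * mult_map t * c"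
  by (induction t rule: tensor_induct)
    (simp_all add: outer_action_lin mult_map_lin mult.assoc distrib_left distrib_right)

lemma cbilinear_rot_inner: "cbilinear (\<lambda>a1 a2. a3 \<otimes> a1 \<otimes> a2)"
  by (rule cbilinearI) (simp_all add: tensor_bilinear)

lemma cbilinear_rot: "cbilinear (\<lambda>t a3. tensor_lift (\<lambda>a1 a2. a3 \<otimes> a1 \<otimes> a2) t)"
  by (rule cbilinearI)
    (simp_all add: tensor_lift_add[OF cbilinear_rot_inner] tensor_lift_scale[OF cbilinear_rot_inner]
      tensor_bilinear tensor_lift_fun_add[OF cbilinear_rot_inner cbilinear_rot_inner]
      tensor_lift_fun_scale[OF cbilinear_rot_inner])

lemma clinear_tensor_rot: "clinear tensor_rot"
  unfolding tensor_rot_def by (rule clinear_tensor_lift[OF cbilinear_rot])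

lemmas tensor_rot_lin = clinearD[OF clinear_tensor_rot]

lemma tensor_rot_tensor [simp]: "tensor_rot (a \<otimes> b \<otimes> c) = c \<otimes> a \<otimes> b"
  by (simp add: tensor_rot_def tensor_lift_tensor[OF cbilinear_rot]
      tensor_lift_tensor[OF cbilinear_rot_inner])

lemma tensor_induct3 [case_names tensor add]:
  assumes "\<And>a b c. P (a \<otimes> b \<otimes> c)" and add: "\<And>x y. P x \<Longrightarrow> P y \<Longrightarrow> P (x + y)"
  shows "P t"
proof (induction t rule: tensor_induct)
  case (tensor s c)
  show ?case
    by (induction s rule: tensor_induct) (simp_all add: assms tensor_add_left)
qed (rule add)

lemma tensor_rot_cubed: "tensor_rot (tensor_rot (tensor_rot t)) = t"
  by (induction t rule: tensor_induct3) (simp_all add: tensor_rot_lin)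

text \<open>The rotation has order three. This replaces \<open>inv\<close> in the double Jacobi
  identity by an explicit map.\<close>

lemma inv_tensor_rot: "inv tensor_rot t = tensor_rot (tensor_rot t)"
proof (rule inv_f_eq)
  show "inj tensor_rot"
    by (rule inj_on_inverseI[where g = "\<lambda>t. tensor_rot (tensor_rot t)"]) (rule tensor_rot_cubed)
qed (rule tensor_rot_cubed)

definition mult_map3 :: "(('a::complex_algebra_1, 'a) tensor, 'a) tensor \<Rightarrow> 'a"
  where "mult_map3 = tensor_lift (\<lambda>t c. mult_map t * c)"

lemma cbilinear_mult_map3: "cbilinear (\<lambda>t c. mult_map t * c)"
  by (rule cbilinearI) (simp_all add: distrib_left distrib_right mult_map_lin)

lemmas mult_map3_lin = clinearD[OF clinear_tensor_lift[OF cbilinear_mult_map3], folded mult_map3_def]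

lemma mult_map3_tensor: "mult_map3 (t \<otimes> c) = mult_map t * c"
  by (simp add: mult_map3_def tensor_lift_tensor[OF cbilinear_mult_map3])

section \<open>The commutator subspace and products with an inserted factor\<close>

definition commutator_span :: "'a::complex_algebra_1 set"
  where "commutator_span = complex_vector.span {a * b - b * a | a b. True}"

lemma commutator_in_span: "a * b - b * a \<in> commutator_span"
  unfolding commutator_span_def by (rule complex_vector.span_base) blast

lemma subspace_commutator_span: "complex_vector.subspace commutator_span"
  unfolding commutator_span_def by (rule complex_vector.subspace_span)

lemmas commutator_span_closed =
  complex_vector.subspace_0[OF subspace_commutator_span]
  complex_vector.subspace_add[OF subspace_commutator_span]
  complex_vector.subspace_neg[OF subspace_commutator_span]
  complex_vector.subspace_scale[OF subspace_commutator_span]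

lemma commutator_span_subset:
  assumes "complex_vector.subspace S" "\<And>a b. a * b - b * a \<in> S"
  shows "commutator_span \<subseteq> S"
  unfolding commutator_span_def using assms by (intro complex_vector.span_minimal) auto

text \<open>On a pure tensor the difference is a single commutator. This is the source of skew
  symmetry modulo \<open>[A,A]\<close>.\<close>

lemma mult_map_flip: "mult_map (tensor_flip t) - mult_map t \<in> commutator_span"
proof (induction t rule: tensor_induct)
  case (tensor a b)
  show ?case by (simp add: commutator_in_span)
next
  case (add x y)
  from commutator_span_closed(2)[OF this] show ?case
    by (simp add: tensor_flip_lin mult_map_lin algebra_simps)
qed

text \<open>Flips the tensor and multiplies it out with \<open>s\<close> inserted between the two
  factors. Such products arise when the Leibniz rule is moved to the first argument of a double
  bracket and when the third term of the double Jacobi identity is multiplied out.\<close>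

definition sandwich :: "'a::complex_algebra_1 \<Rightarrow> ('a, 'a) tensor \<Rightarrow> 'a"
  where "sandwich s = tensor_lift (\<lambda>x y. y * s * x)"

lemma cbilinear_sandwich: "cbilinear (\<lambda>x y. y * s * x)" for s :: "'a::complex_algebra_1"
  by (rule cbilinearI) (simp_all add: distrib_left distrib_right)

lemmas sandwich_lin = clinearD[OF clinear_tensor_lift[OF cbilinear_sandwich], folded sandwich_def]

lemma sandwich_tensor [simp]: "sandwich s (x \<otimes> y) = y * s * x"
  by (simp add: sandwich_def tensor_lift_tensor[OF cbilinear_sandwich])

lemma sandwich_add_left: "sandwich (s + s') t = sandwich s t + sandwich s' t"
  by (induction t rule: tensor_induct) (simp_all add: sandwich_lin distrib_left distrib_right)

lemma sandwich_scale_left: "sandwich (c *\<^sub>C s) t = c *\<^sub>C sandwich s t"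
  by (induction t rule: tensor_induct) (simp_all add: sandwich_lin scaleC_add_right)

lemma mult_map3_rot: "mult_map3 (tensor_rot (t \<otimes> c)) = c * mult_map t"
  by (induction t rule: tensor_induct)
    (simp_all add: tensor_rot_lin mult_map3_lin mult_map3_tensor mult_map_lin distrib_left
      tensor_add_left mult.assoc)

text \<open>Two rotations take \<open>x \<otimes> y \<otimes> c\<close> to
  \<open>y \<otimes> c \<otimes> x\<close>, which puts \<open>c\<close> in the middle.\<close>

lemma mult_map3_rot_rot: "mult_map3 (tensor_rot (tensor_rot (t \<otimes> c))) = sandwich c t"
  by (induction t rule: tensor_induct)
    (simp_all add: tensor_rot_lin mult_map3_lin mult_map3_tensor sandwich_lin
      tensor_add_left mult.assoc)

text \<open>The two outer positions of a tensor become adjacent after the flip, so a factor attached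
  on either side ends up in the middle.\<close>

lemma mult_map_flip_outer:
  "mult_map (tensor_flip (outer_action b t 1)) = sandwich b t"
  "mult_map (tensor_flip (outer_action 1 t c)) = sandwich c t"
  by (induction t rule: tensor_induct;
      simp add: outer_action_lin mult_map_lin tensor_flip_lin sandwich_lin mult.assoc)+

lemma necklace_proj_lin:
  "necklace_proj (a + b) = necklace_proj a + necklace_proj b"
  "necklace_proj (- a) = - necklace_proj a"
  "necklace_proj (c *\<^sub>C a) = c *\<^sub>C necklace_proj a"
  by (transfer, simp add: complex_vector.span_zero)+

lemma necklace_proj_eq_iff: "necklace_proj a = necklace_proj b \<longleftrightarrow> a - b \<in> commutator_span"
  unfolding commutator_span_def by transfer simp

lemma necklace_proj_induct [case_names proj]: "(\<And>a. P (necklace_proj a)) \<Longrightarrow> P w"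
  using necklace_lie.abs_induct[of P w] by (simp add: necklace_proj.abs_eq)

section \<open>From a double Poisson bracket to a Lie bracket on \<open>A/[A,A]\<close>\<close>

context
  fixes db :: "('a::complex_algebra_1, 'a) tensor \<Rightarrow> ('a, 'a) tensor"
  assumes db: "double_poisson_bracket db"
begin

lemma db_linear: "clinear db"
  and db_skew: "db (a \<otimes> b) = - tensor_flip (db (b \<otimes> a))"
  and db_leibniz: "db (a \<otimes> (b * c)) = outer_action b (db (a \<otimes> c)) 1 + outer_action 1 (db (a \<otimes> b)) c"
  and db_jacobi: "bracket_left db a (db (b \<otimes> c)) +
      tensor_rot (bracket_left db b (db (c \<otimes> a))) +
      inv tensor_rot (bracket_left db c (db (a \<otimes> b))) = 0"
  using db unfolding double_poisson_bracket_def by blast+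

lemmas db_lin = clinearD[OF db_linear]

lemma cbilinear_bracket_L: "cbilinear (bracket_L db)"
  by (rule cbilinearI) (simp_all add: bracket_L_def tensor_bilinear db_lin mult_map_lin)

lemmas bracket_L_bilinear = cbilinearD[OF cbilinear_bracket_L]

lemma clinear_bracket_L_left: "clinear (\<lambda>a. bracket_L db a b)"
  and clinear_bracket_L_right: "clinear (bracket_L db a)"
  using cbilinear_bracket_L by (auto simp: cbilinear_def)

lemma bracket_L_mult: "bracket_L db a (b * c) = bracket_L db a b * c + b * bracket_L db a c"
  by (simp add: bracket_L_def db_leibniz mult_map_lin mult_map_outer_action)

lemma bracket_L_skew: "bracket_L db a b - - bracket_L db b a \<in> commutator_span"
  using commutator_span_closed(3)[OF mult_map_flip[of "db (b \<otimes> a)"]]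
  unfolding bracket_L_def by (subst db_skew) (simp add: mult_map_lin algebra_simps)

text \<open>Skew symmetry moves the product into the second argument, where the Leibniz rule
  applies. The result is symmetric in \<open>a\<close> and \<open>b\<close>, hence commutators in
  the first argument give zero.\<close>

lemma bracket_L_mult_left:
  "bracket_L db (a * b) c = - (sandwich a (db (c \<otimes> b)) + sandwich b (db (c \<otimes> a)))"
  unfolding bracket_L_def
  by (subst db_skew) (simp add: db_leibniz mult_map_lin tensor_flip_lin mult_map_flip_outer)

lemma bracket_L_commutator_left:
  assumes "x \<in> commutator_span"
  shows "bracket_L db x c = 0"
proof -
  have "commutator_span \<subseteq> {x. bracket_L db x c = 0}"
    by (rule commutator_span_subset)
      (simp_all add: complex_vector.subspace_def clinearD[OF clinear_bracket_L_left]
        bracket_L_mult_left)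
  with assms show ?thesis by blast
qed

text \<open>A derivation \<open>d\<close> sends \<open>[b, c]\<close> to
  \<open>[d b, c] + [b, d c]\<close>.\<close>

lemma bracket_L_commutator_right:
  assumes "x \<in> commutator_span"
  shows "bracket_L db a x \<in> commutator_span"
proof -
  have "commutator_span \<subseteq> {x. bracket_L db a x \<in> commutator_span}"
  proof (rule commutator_span_subset)
    show "complex_vector.subspace {x. bracket_L db a x \<in> commutator_span}"
      by (simp add: complex_vector.subspace_def clinearD[OF clinear_bracket_L_right]
          commutator_span_closed)
    fix b c
    have "bracket_L db a (b * c - c * b) = (bracket_L db a b * c - c * bracket_L db a b) +
        (b * bracket_L db a c - bracket_L db a c * b)"
      by (simp add: clinearD[OF clinear_bracket_L_right] bracket_L_mult)
    then show "b * c - c * b \<in> {x. bracket_L db a x \<in> commutator_span}"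
      by (simp only: mem_Collect_eq commutator_span_closed commutator_in_span)
  qed
  with assms show ?thesis by blast
qed

text \<open>The multiplied double Jacobi identity for \<open>(a, b, c)\<close> minus the one for \<open>(b, a, c)\<close>
  is the Leibniz form of the Jacobi identity.\<close>

lemma bracket_L_jacobi:
  "bracket_L db a (bracket_L db b c) = bracket_L db (bracket_L db a b) c + bracket_L db b (bracket_L db a c)"
proof -
  \<comment> \<open>These are the three shapes of the terms of the double Jacobi identity after
    multiplication: \<open>\<alpha>\<close> and \<open>\<beta>\<close> apply the bracket with a
    fixed element to the left or right tensor factor, while \<open>\<gamma>\<close> takes the double
    bracket with the left factor and inserts the right one into its middle.\<close>
  define \<alpha> where "\<alpha> a = tensor_lift (\<lambda>u v. bracket_L db a u * v)" for a
  define \<beta> where "\<beta> a = tensor_lift (\<lambda>u v. u * bracket_L db a v)" for a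
  define \<gamma> where "\<gamma> c = tensor_lift (\<lambda>r s. sandwich s (db (c \<otimes> r)))" for c
  have \<alpha>_bil: "cbilinear (\<lambda>u v. bracket_L db a u * v)" for a
    by (rule cbilinearI) (simp_all add: bracket_L_bilinear distrib_left distrib_right)
  have \<beta>_bil: "cbilinear (\<lambda>u v. u * bracket_L db a v)" for a
    by (rule cbilinearI) (simp_all add: bracket_L_bilinear distrib_left distrib_right)
  have \<gamma>_bil: "cbilinear (\<lambda>r s. sandwich s (db (c \<otimes> r)))" for c
    by (rule cbilinearI)
      (simp_all add: sandwich_lin sandwich_add_left sandwich_scale_left db_lin tensor_bilinear)
  have left_bil: "cbilinear (\<lambda>u v. db (a \<otimes> u) \<otimes> v)" for a
    by (rule cbilinearI) (simp_all add: db_lin tensor_bilinear)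
  note \<alpha>_lin = clinearD[OF clinear_tensor_lift[OF \<alpha>_bil], folded \<alpha>_def]
    and \<beta>_lin = clinearD[OF clinear_tensor_lift[OF \<beta>_bil], folded \<beta>_def]
    and \<gamma>_lin = clinearD[OF clinear_tensor_lift[OF \<gamma>_bil], folded \<gamma>_def]
    and \<alpha>_tensor = tensor_lift_tensor[OF \<alpha>_bil, folded \<alpha>_def]
    and \<beta>_tensor = tensor_lift_tensor[OF \<beta>_bil, folded \<beta>_def]
    and \<gamma>_tensor = tensor_lift_tensor[OF \<gamma>_bil, folded \<gamma>_def]
  have left_linear: "clinear (bracket_left db a)" for a
    unfolding bracket_left_def by (rule clinear_tensor_lift[OF left_bil])
  note left_lin = clinearD[OF left_linear]
  have left_tensor: "bracket_left db a (u \<otimes> v) = db (a \<otimes> u) \<otimes> v" for a u v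
    by (simp add: bracket_left_def tensor_lift_tensor[OF left_bil])
  have left_\<alpha>: "mult_map3 (bracket_left db a t) = \<alpha> a t" for a t
    by (induction t rule: tensor_induct)
      (simp_all add: left_tensor left_lin \<alpha>_tensor \<alpha>_lin mult_map3_lin mult_map3_tensor bracket_L_def)
  have left_\<beta>: "mult_map3 (tensor_rot (bracket_left db a t)) = \<beta> a (tensor_flip t)" for a t
    by (induction t rule: tensor_induct)
      (simp_all add: left_tensor left_lin \<beta>_tensor \<beta>_lin mult_map3_lin tensor_rot_lin
        tensor_flip_lin mult_map3_rot bracket_L_def)
  have left_\<gamma>: "mult_map3 (tensor_rot (tensor_rot (bracket_left db a t))) = \<gamma> a t" for a t
    by (induction t rule: tensor_induct)
      (simp_all add: left_tensor left_lin \<gamma>_tensor \<gamma>_lin mult_map3_lin tensor_rot_lin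
        mult_map3_rot_rot)
  \<comment> \<open>The flip in \<open>left_\<beta>\<close> is absorbed by skew symmetry, which
    exchanges \<open>c\<close> and \<open>a\<close> and produces the minus sign.\<close>
  have jac: "\<alpha> a (db (b \<otimes> c)) - \<beta> b (db (a \<otimes> c)) + \<gamma> c (db (a \<otimes> b)) = 0" for a b c
    using arg_cong[OF db_jacobi[of a b c], of mult_map3]
    by (simp add: inv_tensor_rot mult_map3_lin left_\<alpha> left_\<beta> left_\<gamma> db_skew[of a c] \<beta>_lin)
  have right: "bracket_L db a (mult_map t) = \<alpha> a t + \<beta> a t" for a t
    by (induction t rule: tensor_induct)
      (simp_all add: \<alpha>_tensor \<alpha>_lin \<beta>_tensor \<beta>_lin mult_map_lin bracket_L_bilinear bracket_L_mult)
  \<comment> \<open>For \<open>t = r \<otimes> s\<close> the two summands of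
    \<open>bracket_L_mult_left\<close> are the \<open>\<gamma>\<close> terms of
    \<open>s \<otimes> r\<close> and of \<open>r \<otimes> s\<close>.\<close>
  have mid: "bracket_L db (mult_map t) c = - (\<gamma> c t + \<gamma> c (tensor_flip t))" for c t
    by (induction t rule: tensor_induct)
      (simp_all add: \<gamma>_tensor \<gamma>_lin mult_map_lin bracket_L_bilinear bracket_L_mult_left
        tensor_flip_lin)
  have flip: "\<gamma> c (tensor_flip (db (a \<otimes> b))) = - \<gamma> c (db (b \<otimes> a))"
    by (simp add: db_skew[of b a] \<gamma>_lin)
  have "bracket_L db a (bracket_L db b c) = \<alpha> a (db (b \<otimes> c)) + \<beta> a (db (b \<otimes> c))"
    "bracket_L db b (bracket_L db a c) = \<alpha> b (db (a \<otimes> c)) + \<beta> b (db (a \<otimes> c))"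
    "bracket_L db (bracket_L db a b) c = - (\<gamma> c (db (a \<otimes> b)) + \<gamma> c (tensor_flip (db (a \<otimes> b))))"
    by (simp_all only: bracket_L_def[of db b c] bracket_L_def[of db a c] bracket_L_def[of db a b]
        right mid)
  \<comment> \<open>Once the \<open>\<beta>\<close> terms are eliminated, the
    \<open>\<alpha>\<close> terms agree on both sides and only \<open>\<gamma>\<close> terms remain;
    \<open>flip\<close> reconciles these.\<close>
  moreover have "\<beta> b (db (a \<otimes> c)) = \<alpha> a (db (b \<otimes> c)) + \<gamma> c (db (a \<otimes> b))"
    "\<beta> a (db (b \<otimes> c)) = \<alpha> b (db (a \<otimes> c)) + \<gamma> c (db (b \<otimes> a))"
    using jac[of a b c] jac[of b a c] by (simp_all add: algebra_simps)
  ultimately show ?thesis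
    by (simp add: flip)
qed

text \<open>The definite description has exactly one solution: the class of
  \<open>bracket_L db a b\<close> depends only on the classes of \<open>a\<close> and
  \<open>b\<close>, so chosen representatives give existence, and surjectivity of
  \<open>necklace_proj\<close> gives uniqueness.\<close>

lemma necklace_bracket_proj:
  "necklace_bracket db (necklace_proj a) (necklace_proj b) = necklace_proj (bracket_L db a b)"
proof -
  have cong: "necklace_proj (bracket_L db a b) = necklace_proj (bracket_L db a' b')"
    if "necklace_proj a = necklace_proj a'" "necklace_proj b = necklace_proj b'" for a b a' b'
  proof -
    have "bracket_L db a b = bracket_L db a' b"
      using bracket_L_commutator_left[of "a - a'" b] that
      by (simp add: necklace_proj_eq_iff clinearD[OF clinear_bracket_L_left])
    then show ?thesis
      using bracket_L_commutator_right[of "b - b'" a'] that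
      by (simp add: necklace_proj_eq_iff clinearD[OF clinear_bracket_L_right])
  qed
  define r :: "'a necklace_lie \<Rightarrow> 'a" where "r w = (SOME a. necklace_proj a = w)" for w
  have r: "necklace_proj (r (necklace_proj a)) = necklace_proj a" for a
    unfolding r_def by (rule someI) (rule refl)
  have "\<exists>!br. \<forall>a b. br (necklace_proj a) (necklace_proj b) = necklace_proj (bracket_L db a b)"
  proof (rule ex1I)
    show "\<forall>a b. (\<lambda>v w. necklace_proj (bracket_L db (r v) (r w))) (necklace_proj a) (necklace_proj b)
      = necklace_proj (bracket_L db a b)"
      by (auto intro!: cong r)
    fix br assume br: "\<forall>a b. br (necklace_proj a) (necklace_proj b) = necklace_proj (bracket_L db a b)"
    show "br = (\<lambda>v w. necklace_proj (bracket_L db (r v) (r w)))"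
    proof (intro ext)
      fix v w show "br v w = necklace_proj (bracket_L db (r v) (r w))"
        by (induction v rule: necklace_proj_induct, induction w rule: necklace_proj_induct)
          (auto simp: br intro!: cong r[symmetric])
    qed
  qed
  from theI'[OF this] show ?thesis unfolding necklace_bracket_def by blast
qed

lemma cbilinear_necklace_bracket: "cbilinear (necklace_bracket db)"
proof (rule cbilinearI)
  fix u v w :: "'a necklace_lie" and c
  show "necklace_bracket db (u + v) w = necklace_bracket db u w + necklace_bracket db v w"
    by (induction u rule: necklace_proj_induct, induction v rule: necklace_proj_induct,
        induction w rule: necklace_proj_induct)
      (simp add: necklace_bracket_proj bracket_L_bilinear flip: necklace_proj_lin)
  show "necklace_bracket db u (v + w) = necklace_bracket db u v + necklace_bracket db u w"
    by (induction u rule: necklace_proj_induct, induction v rule: necklace_proj_induct,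
        induction w rule: necklace_proj_induct)
      (simp add: necklace_bracket_proj bracket_L_bilinear flip: necklace_proj_lin)
  show "necklace_bracket db (c *\<^sub>C u) v = c *\<^sub>C necklace_bracket db u v"
    by (induction u rule: necklace_proj_induct, induction v rule: necklace_proj_induct)
      (simp add: necklace_bracket_proj bracket_L_bilinear flip: necklace_proj_lin)
  show "necklace_bracket db u (c *\<^sub>C v) = c *\<^sub>C necklace_bracket db u v"
    by (induction u rule: necklace_proj_induct, induction v rule: necklace_proj_induct)
      (simp add: necklace_bracket_proj bracket_L_bilinear flip: necklace_proj_lin)
qed

lemma necklace_bracket_skew: "necklace_bracket db u v = - necklace_bracket db v u"
proof (induction u rule: necklace_proj_induct, induction v rule: necklace_proj_induct)
  case (proj b a)
  then show ?case
    using bracket_L_skew[of a b]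
    by (simp only: necklace_bracket_proj necklace_proj_eq_iff flip: necklace_proj_lin)
qed

text \<open>The Leibniz form descends from \<open>A\<close>; skew symmetry on the quotient turns it
  into the cyclic form.\<close>

lemma necklace_bracket_jacobi:
  "necklace_bracket db u (necklace_bracket db v w) + necklace_bracket db v (necklace_bracket db w u) +
    necklace_bracket db w (necklace_bracket db u v) = 0"
proof -
  have neg: "necklace_bracket db x (- y) = - necklace_bracket db x y" for x y
    using cbilinear_necklace_bracket by (simp add: cbilinear_def clinearD)
  have "necklace_bracket db u (necklace_bracket db v w) =
      necklace_bracket db (necklace_bracket db u v) w + necklace_bracket db v (necklace_bracket db u w)"
    by (induction u rule: necklace_proj_induct, induction v rule: necklace_proj_induct,
        induction w rule: necklace_proj_induct)
      (simp add: necklace_bracket_proj flip: necklace_proj_lin bracket_L_jacobi)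
  moreover have "necklace_bracket db v (necklace_bracket db w u) =
      - necklace_bracket db v (necklace_bracket db u w)"
    by (subst necklace_bracket_skew[of w u]) (rule neg)
  moreover have "necklace_bracket db w (necklace_bracket db u v) =
      - necklace_bracket db (necklace_bracket db u v) w"
    by (rule necklace_bracket_skew)
  ultimately show ?thesis by simp
qed

end

section \<open>The Lie-Poisson bracket\<close>

locale lie_bracket =
  fixes br :: "'v::complex_vector \<Rightarrow> 'v \<Rightarrow> 'v"
  assumes bilinear: "cbilinear br"
    and skew: "br u v = - br v u"
    and jacobi: "br u (br v w) + br v (br w u) + br w (br u v) = 0"
begin

text \<open>For a vector \<open>u\<close>, extend \<open>br u\<close> to a derivation
  \<open>D u\<close> of \<open>S(V)\<close>; then, for each \<open>y\<close>, extend
  \<open>u \<mapsto> D u y\<close> to a derivation \<open>Q y\<close> in the first argument.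
  Properties of \<open>Q y x\<close> in \<open>y\<close> are identities between derivations in
  \<open>x\<close>, so they reduce to the known ones for \<open>D\<close>.\<close>

lemma lie_poisson_bracket_exists:
  "\<exists>P. (\<forall>x. derivation (P x)) \<and> (\<forall>y. derivation (\<lambda>x. P x y)) \<and>
    (\<forall>u v. P (sym_incl u) (sym_incl v) = sym_incl (br u v))"
proof -
  have id: "clinear (\<lambda>x. x :: 'v sym_algebra)"
    by (rule clinearI) simp_all
  note extension = derivation_along_sym_extension[OF id refl refl, unfolded derivation_along_id]
    and unique = derivation_along_sym_unique[where \<phi> = "\<lambda>x. x", unfolded derivation_along_id, OF _ _ refl]
  have "\<exists>D. derivation D \<and> (\<forall>v. D (sym_incl v) = sym_incl (br u v))" for u
    by (rule extension, rule clinearI) (simp_all add: cbilinearD[OF bilinear] sym_incl_lin)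
  then obtain D where D: "derivation (D u)" "D u (sym_incl v) = sym_incl (br u v)" for u v
    by metis
  note D_rules = derivationD[OF D(1)]
  have D_add: "D (u + u') y = D u y + D u' y" for u u' y
    by (rule unique[of "D (u + u')" "\<lambda>y. D u y + D u' y", OF D(1)])
      (simp_all add: derivation_def clinearI D D_rules scaleC_add_right distrib_left distrib_right algebra_simps
        cbilinearD[OF bilinear] sym_incl_lin)
  have D_scale: "D (c *\<^sub>C u) y = c *\<^sub>C D u y" for u c y
    by (rule unique[of "D (c *\<^sub>C u)" "\<lambda>y. c *\<^sub>C D u y", OF D(1)])
      (simp_all add: derivation_def clinearI D D_rules scaleC_add_right scaleC_scaleC mult.commute
        cbilinearD[OF bilinear] sym_incl_lin)
  have "\<exists>Q. derivation Q \<and> (\<forall>u. Q (sym_incl u) = D u y)" for y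
    by (rule extension, rule clinearI) (simp_all add: D_add D_scale)
  then obtain Q where Q: "derivation (Q y)" "Q y (sym_incl u) = D u y" for y u
    by metis
  note Q_rules = derivationD[OF Q(1)]
  have Q_add: "Q (y + y') x = Q y x + Q y' x" for y y' x
    by (rule unique[of "Q (y + y')" "\<lambda>x. Q y x + Q y' x", OF Q(1)])
      (simp_all add: derivation_def clinearI Q Q_rules D_rules scaleC_add_right algebra_simps)
  have Q_scale: "Q (c *\<^sub>C y) x = c *\<^sub>C Q y x" for c y x
    by (rule unique[of "Q (c *\<^sub>C y)" "\<lambda>x. c *\<^sub>C Q y x", OF Q(1)])
      (simp_all add: derivation_def clinearI Q Q_rules D_rules scaleC_add_right scaleC_scaleC mult.commute)
  have Q_mult: "Q (y * y') x = Q y x * y' + y * Q y' x" for y y' x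
  proof (rule unique[of "Q (y * y')" "\<lambda>x. Q y x * y' + y * Q y' x", OF Q(1)])
    \<comment> \<open>Multiplying a derivation of a commutative algebra by a fixed element gives a
      derivation again.\<close>
    show "derivation (\<lambda>x. Q y x * y' + y * Q y' x)"
    proof (rule derivation_along_id[THEN iffD1, OF derivation_alongI])
      fix a b c
      show "Q y (a + b) * y' + y * Q y' (a + b) = Q y a * y' + y * Q y' a + (Q y b * y' + y * Q y' b)"
        by (simp add: Q_rules distrib_left distrib_right)
      show "Q y (c *\<^sub>C a) * y' + y * Q y' (c *\<^sub>C a) = c *\<^sub>C (Q y a * y' + y * Q y' a)"
        by (simp add: Q_rules scaleC_add_right)
      show "Q y (a * b) * y' + y * Q y' (a * b) = a * (Q y b * y' + y * Q y' b) + b * (Q y a * y' + y * Q y' a)"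
        by (simp only: Q_rules ring_distribs mult_ac add_ac)
    qed
    show "Q (y * y') (sym_incl v) = Q y (sym_incl v) * y' + y * Q y' (sym_incl v)" for v
      by (simp only: Q(2) D_rules)
  qed
  have "derivation (\<lambda>y. Q y x)" for x
    by (simp add: derivation_def clinearI Q_add Q_scale Q_mult)
  moreover have "Q (sym_incl v) (sym_incl u) = sym_incl (br u v)" for u v
    by (simp add: Q D)
  ultimately show ?thesis
    using Q(1) by (intro exI[of _ "\<lambda>x y. Q y x"]) simp
qed

text \<open>Uniqueness of derivations is applied twice: first in \<open>y\<close> with a generator
  in the first slot, then in \<open>x\<close>.\<close>

lemma biderivation_eqI:
  fixes P P' :: "'v sym_algebra \<Rightarrow> 'v sym_algebra \<Rightarrow> 'v sym_algebra"
  assumes "\<And>x. derivation (P x)" "\<And>y. derivation (\<lambda>x. P x y)"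
    and "\<And>x. derivation (P' x)" "\<And>y. derivation (\<lambda>x. P' x y)"
    and "\<And>u v. P (sym_incl u) (sym_incl v) = P' (sym_incl u) (sym_incl v)"
  shows "P x y = P' x y"
proof -
  note unique = derivation_along_sym_unique[where \<phi> = "\<lambda>x. x", unfolded derivation_along_id, OF _ _ refl]
  have "P (sym_incl u) y = P' (sym_incl u) y" for u y
    by (rule unique) (rule assms)+
  then show ?thesis
    by (rule unique[of "\<lambda>x. P x y" "\<lambda>x. P' x y", OF assms(2,4)])
qed

lemma lie_poisson_bracket:
  shows derivation_lie_poisson: "derivation (lie_poisson_bracket br x)"
    and derivation_lie_poisson_left: "derivation (\<lambda>x. lie_poisson_bracket br x y)"
    and lie_poisson_incl:
      "lie_poisson_bracket br (sym_incl u) (sym_incl v) = sym_incl (br u v)"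
proof -
  have "\<exists>!P. (\<forall>x. derivation (P x)) \<and> (\<forall>y. derivation (\<lambda>x. P x y)) \<and>
    (\<forall>u v. P (sym_incl u) (sym_incl v) = sym_incl (br u v))"
    (is "\<exists>!P. ?spec P")
  proof (rule ex_ex1I[OF lie_poisson_bracket_exists])
    fix P P' assume P: "?spec P" and P': "?spec P'"
    have "P x y = P' x y" for x y
      by (rule biderivation_eqI[of P P']) (simp_all add: P P')
    then show "P = P'" by (intro ext)
  qed
  note spec = theI'[OF this, folded lie_poisson_bracket_def]
  show "derivation (lie_poisson_bracket br x)"
    by (rule spec[THEN conjunct1, THEN HOL.spec])
  show "derivation (\<lambda>x. lie_poisson_bracket br x y)"
    by (rule spec[THEN conjunct2, THEN conjunct1, THEN HOL.spec])
  show "lie_poisson_bracket br (sym_incl u) (sym_incl v) = sym_incl (br u v)"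
    by (rule spec[THEN conjunct2, THEN conjunct2, THEN HOL.spec, THEN HOL.spec])
qed

lemmas lie_poisson_rules =
  derivationD[OF derivation_lie_poisson] derivationD[OF derivation_lie_poisson_left]

lemma lie_poisson_skew: "lie_poisson_bracket br x y = - lie_poisson_bracket br y x"
proof (rule biderivation_eqI[of "lie_poisson_bracket br" "\<lambda>x y. - lie_poisson_bracket br y x"])
  show "derivation (\<lambda>y. - lie_poisson_bracket br y x)" for x
    by (simp add: derivation_def clinearI lie_poisson_rules)
  show "derivation (\<lambda>x. - lie_poisson_bracket br y x)" for y
    by (simp add: derivation_def clinearI lie_poisson_rules)
  show "lie_poisson_bracket br (sym_incl u) (sym_incl v) = - lie_poisson_bracket br (sym_incl v) (sym_incl u)"
    for u v
    unfolding lie_poisson_incl by (subst skew) (rule sym_incl_lin)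
qed (rule derivation_lie_poisson derivation_lie_poisson_left)+

text \<open>The cyclic sum is a derivation in its first argument and invariant under cyclic
  rotation. It vanishes on generators, which are then replaced by arbitrary elements one slot at a
  time.\<close>

lemma lie_poisson_jacobi:
  "lie_poisson_bracket br x (lie_poisson_bracket br y z) +
    lie_poisson_bracket br y (lie_poisson_bracket br z x) +
    lie_poisson_bracket br z (lie_poisson_bracket br x y) = 0" (is "?J x y z = 0")
proof -
  let ?P = "lie_poisson_bracket br"
  note unique = derivation_along_sym_unique[where \<phi> = "\<lambda>x. x", unfolded derivation_along_id, OF _ _ refl]
  have zero: "derivation (\<lambda>_::'v sym_algebra. 0)"
    by (simp add: derivation_def clinearI)
  have cyclic: "?J x y z = ?J y z x" for x y z
    by (simp add: add_ac)
  have deriv: "derivation (\<lambda>x. ?J x y z)" for y z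
  proof (rule derivation_along_id[THEN iffD1, OF derivation_alongI])
    have "clinear (?P w)" for w
      using derivation_lie_poisson by (simp add: derivation_def)
    note lin = clinearD[OF this]
    fix x x'
    \<comment> \<open>With these orientations the mixed products of two brackets, which obstruct the
      Leibniz rule, cancel in pairs.\<close>
    have "?P x y = - ?P y x" "?P x' y = - ?P y x'"
      by (rule lie_poisson_skew)+
    then show "?J (x * x') y z = x * ?J x' y z + x' * ?J x y z"
      by (simp add: lie_poisson_rules lin algebra_simps)
  qed (simp_all add: lie_poisson_rules scaleC_add_right)
  have "?J (sym_incl u) (sym_incl v) (sym_incl w) = 0" for u v w
    using jacobi[of u v w] by (simp add: lie_poisson_incl sym_incl_lin flip: sym_incl_lin(1))
  then have "?J x (sym_incl v) (sym_incl w) = 0" for x v w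
    by (rule unique[OF deriv zero])
  \<comment> \<open>Cyclic invariance rotates the next slot holding a generator to the front, where
    uniqueness of derivations applies.\<close>
  then have "?J y (sym_incl w) x = 0" for x y w
    using unique[OF deriv[of "sym_incl w" x] zero, of y] cyclic by metis
  then show ?thesis
    using unique[OF deriv[of y z] zero, of x] cyclic by metis
qed

end

section \<open>The trace algebra\<close>

lemma tensor_derivationI:
  fixes D :: "('a::complex_algebra_1, 'b::complex_algebra_1) tensor \<Rightarrow> ('a, 'b) tensor"
  assumes D: "clinear D"
    and mult: "\<And>a b a' b'. D ((a \<otimes> b) * (a' \<otimes> b')) = D (a \<otimes> b) * (a' \<otimes> b') + (a \<otimes> b) * D (a' \<otimes> b')"
  shows "derivation D"
proof -
  note D_lin = clinearD[OF D]
  have "D ((a \<otimes> b) * y) = D (a \<otimes> b) * y + (a \<otimes> b) * D y" for a b y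
    by (induction y rule: tensor_induct) (simp_all add: mult D_lin distrib_left)
  then have "D (x * y) = D x * y + x * D y" for x y
    by (induction x rule: tensor_induct) (simp_all add: D_lin distrib_right)
  with D show ?thesis by (simp add: derivation_def)
qed

text \<open>The two factors generate the tensor product, because
  \<open>a \<otimes> b = (a \<otimes> 1) * (1 \<otimes> b)\<close>.\<close>

lemma tensor_derivation_eqI:
  fixes D :: "('a::complex_algebra_1, 'b::complex_algebra_1) tensor \<Rightarrow> ('a, 'b) tensor"
  assumes D: "derivation D" and D': "derivation D'"
    and "\<And>a. D (a \<otimes> 1) = D' (a \<otimes> 1)" "\<And>b. D (1 \<otimes> b) = D' (1 \<otimes> b)"
  shows "D t = D' t"
proof (induction t rule: tensor_induct)
  case (tensor a b)
  have "a \<otimes> b = (a \<otimes> 1) * (1 \<otimes> b)" by (simp add: tensor_mult)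
  then show ?case by (simp add: derivationD(3)[OF D] derivationD(3)[OF D'] assms)
qed (simp add: derivationD(1)[OF D] derivationD(1)[OF D'])

lemma tensor_derivation_exists:
  fixes d :: "'a::complex_algebra_1 \<Rightarrow> 'a" and e :: "'b::complex_algebra_1 \<Rightarrow> 'b"
  assumes d: "derivation d" and e: "derivation e"
  shows "\<exists>D. derivation D \<and> (\<forall>a b. D (a \<otimes> b) = d a \<otimes> b + a \<otimes> e b)"
proof -
  have bil: "cbilinear (\<lambda>a b. d a \<otimes> b + a \<otimes> e b)"
    by (rule cbilinearI)
      (simp_all add: derivationD[OF d] derivationD[OF e] tensor_bilinear scaleC_add_right)
  have "derivation (tensor_lift (\<lambda>a b. d a \<otimes> b + a \<otimes> e b))"
    by (rule tensor_derivationI)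
      (simp_all add: clinear_tensor_lift[OF bil] tensor_lift_tensor[OF bil] tensor_mult
        derivationD[OF d] derivationD[OF e] distrib_left distrib_right tensor_bilinear)
  with tensor_lift_tensor[OF bil] show ?thesis by blast
qed

lemma derivation_one: "derivation D \<Longrightarrow> D 1 = 0"
  using derivationD(3)[of D 1 1] by simp

lemma tensor_left_central:
  "(z \<otimes> 1) * t = t * (z \<otimes> 1)" for z :: "'v::complex_vector sym_algebra"
  by (induction t rule: tensor_induct) (simp_all add: tensor_mult distrib_left distrib_right mult.commute)

lemma clinear_in_trace: "clinear (necklace_in_trace :: 'a::complex_algebra_1 necklace_algebra \<Rightarrow> _)"
  by (rule clinearI) (simp_all add: necklace_in_trace_def tensor_bilinear)

lemma in_trace_mult: "necklace_in_trace (x * y) = necklace_in_trace x * necklace_in_trace y"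
  and in_trace_one: "necklace_in_trace 1 = 1"
  by (simp_all add: necklace_in_trace_def tensor_mult one_tensor_def)

section \<open>Hamiltonian derivations of the trace algebra\<close>

context
  fixes db :: "('a::complex_algebra_1, 'a) tensor \<Rightarrow> ('a, 'a) tensor"
  assumes db: "double_poisson_bracket db"
begin

interpretation lie_bracket "necklace_bracket db"
  using cbilinear_necklace_bracket[OF db] necklace_bracket_skew[OF db]
    necklace_bracket_jacobi[OF db]
  by unfold_locales blast+

lemma derivation_bracket_L: "derivation (bracket_L db a)"
  using clinear_bracket_L_right[OF db] bracket_L_mult[OF db] by (simp add: derivation_def)

text \<open>This repeats the property inside the definite description of
  \<open>trace_hamiltonian\<close>, so that existence and uniqueness can be stated
  separately.\<close>

abbreviation (input) hamiltonian_spec ::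
    "('a necklace_algebra \<Rightarrow> 'a trace_algebra \<Rightarrow> 'a trace_algebra) \<Rightarrow> bool"
  where "hamiltonian_spec H \<equiv> (\<forall>t. clinear (\<lambda>z. H z t)) \<and>
      (\<forall>z z' t. H (z * z') t = (z \<otimes> 1) * H z' t + (z' \<otimes> 1) * H z t) \<and>
      (\<forall>w. derivation (H (sym_incl w))) \<and>
      (\<forall>w z. H (sym_incl w) (z \<otimes> 1) = necklace_poisson_bracket db (sym_incl w) z \<otimes> 1) \<and>
      (\<forall>a b. H (sym_incl (necklace_proj a)) (1 \<otimes> b) = 1 \<otimes> bracket_L db a b)"

text \<open>At a fixed \<open>t\<close>, \<open>H\<close> is a derivation from \<open>N\<close> into
  \<open>T\<close> as a module over \<open>N\<close>; the extension and uniqueness results for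
  symmetric algebras therefore apply in the variable \<open>z\<close>.\<close>

lemma hamiltonian_derivation_along:
  "hamiltonian_spec H \<Longrightarrow> derivation_along necklace_in_trace (\<lambda>z. H z t)"
  by (simp add: derivation_along_def necklace_in_trace_def)

text \<open>First a derivation \<open>D w\<close> of \<open>T\<close> is formed for each
  \<open>w\<close> in \<open>A/[A,A]\<close> as the sum of the Poisson derivation on
  \<open>N\<close> and the bracket derivation on \<open>A\<close>. Then, for each fixed
  \<open>t\<close>, the linear map \<open>w \<mapsto> D w t\<close> is extended to \<open>N\<close>
  by the Leibniz rule.\<close>

lemma hamiltonian_exists: "\<exists>H. hamiltonian_spec H"
proof -
  \<comment> \<open>All lifts \<open>a\<close> of \<open>w\<close> are covered at once, so that a
    single choice of \<open>D w\<close> serves every lift.\<close>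
  have "\<exists>D. derivation D \<and> (\<forall>z. D (z \<otimes> 1) = necklace_poisson_bracket db (sym_incl w) z \<otimes> 1) \<and>
      (\<forall>a b. w = necklace_proj a \<longrightarrow> D (1 \<otimes> b) = 1 \<otimes> bracket_L db a b)" for w
  proof (induction w rule: necklace_proj_induct)
    case (proj a)
    obtain D where D: "derivation D" "\<And>z b. D (z \<otimes> b) =
        necklace_poisson_bracket db (sym_incl (necklace_proj a)) z \<otimes> b + z \<otimes> bracket_L db a b"
      using tensor_derivation_exists[OF derivation_lie_poisson[of "sym_incl (necklace_proj a)"]
          derivation_bracket_L[of a]]
      unfolding necklace_poisson_bracket_def by blast
    \<comment> \<open>Derivations kill \<open>1\<close>, so on \<open>z \<otimes> 1\<close> and on
      \<open>1 \<otimes> b\<close> only one summand of \<open>D\<close> survives.\<close>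
    have zero: "bracket_L db a 1 = 0"
      "necklace_poisson_bracket db (sym_incl (necklace_proj a)) 1 = 0"
      unfolding necklace_poisson_bracket_def
      by (rule derivation_one[OF derivation_bracket_L] derivation_one[OF derivation_lie_poisson])+
    have tensor_zero: "(0::'a necklace_algebra) \<otimes> b = 0" "z \<otimes> (0::'a) = 0" for b z
      using tensor_scale_left[of 0 0 b] tensor_scale_right[of z 0 0] by simp_all
    have lift: "bracket_L db a b = bracket_L db a' b" if "necklace_proj a = necklace_proj a'" for a' b
      using that bracket_L_commutator_left[OF db, of "a - a'" b]
      by (simp add: necklace_proj_eq_iff clinearD[OF clinear_bracket_L_left[OF db]])
    show ?case
    proof (intro exI[of _ D] conjI allI impI)
      show "D (z \<otimes> 1) = necklace_poisson_bracket db (sym_incl (necklace_proj a)) z \<otimes> 1" for z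
        by (simp add: D(2) zero tensor_zero)
      show "D (1 \<otimes> b) = 1 \<otimes> bracket_L db a' b" if "necklace_proj a = necklace_proj a'" for a' b
        unfolding lift[OF that, symmetric] by (simp add: D(2) zero tensor_zero)
    qed (rule D(1))
  qed
  then obtain D where D: "derivation (D w)"
    "D w (z \<otimes> 1) = necklace_poisson_bracket db (sym_incl w) z \<otimes> 1"
    "D (necklace_proj a) (1 \<otimes> b) = 1 \<otimes> bracket_L db a b" for w z a b
    by metis
  \<comment> \<open>The maps \<open>D w\<close> were chosen independently for each \<open>w\<close>;
    linearity in \<open>w\<close> holds because derivations of \<open>T\<close> are determined on
    the two factors.\<close>
  have D_linear: "clinear (\<lambda>w. D w t)" for t
  proof (rule clinearI)
    fix w w' c
    show "D (w + w') t = D w t + D w' t"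
    proof (rule tensor_derivation_eqI[where D = "D (w + w')" and D' = "\<lambda>t. D w t + D w' t"])
      show "derivation (\<lambda>t. D w t + D w' t)"
        by (simp add: derivation_def clinearI derivationD[OF D(1)] algebra_simps scaleC_add_right)
      show "D (w + w') (1 \<otimes> b) = D w (1 \<otimes> b) + D w' (1 \<otimes> b)" for b
        by (induction w rule: necklace_proj_induct, induction w' rule: necklace_proj_induct)
          (simp add: D bracket_L_bilinear[OF db] tensor_bilinear flip: necklace_proj_lin)
    qed (simp_all add: D necklace_poisson_bracket_def sym_incl_lin lie_poisson_rules tensor_bilinear)
    show "D (c *\<^sub>C w) t = c *\<^sub>C D w t"
    proof (rule tensor_derivation_eqI[where D = "D (c *\<^sub>C w)" and D' = "\<lambda>t. c *\<^sub>C D w t"])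
      show "derivation (\<lambda>t. c *\<^sub>C D w t)"
        by (simp add: derivation_def clinearI derivationD[OF D(1)] scaleC_add_right scaleC_scaleC
            mult.commute)
      show "D (c *\<^sub>C w) (1 \<otimes> b) = c *\<^sub>C D w (1 \<otimes> b)" for b
        by (induction w rule: necklace_proj_induct)
          (simp add: D bracket_L_bilinear[OF db] tensor_bilinear flip: necklace_proj_lin)
    qed (simp_all add: D necklace_poisson_bracket_def sym_incl_lin lie_poisson_rules tensor_bilinear)
  qed
  have "\<exists>F. derivation_along necklace_in_trace F \<and> (\<forall>w. F (sym_incl w) = D w t)" for t
    using clinear_in_trace in_trace_one in_trace_mult D_linear
    by (rule derivation_along_sym_extension)
  then obtain F where F: "derivation_along necklace_in_trace (F t)" "F t (sym_incl w) = D w t" for t w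
    by metis
  show ?thesis
    by (rule exI[of _ "\<lambda>z t. F t z"])
      (use F(1) D in \<open>simp add: F(2) derivation_along_def necklace_in_trace_def\<close>)
qed

lemma hamiltonian_unique:
  assumes H: "hamiltonian_spec H" and H': "hamiltonian_spec H'"
  shows "H = H'"
proof (intro ext)
  fix z t
  have "H (sym_incl w) t = H' (sym_incl w) t" for w t
  proof (induction w rule: necklace_proj_induct)
    case (proj a)
    show ?case
      by (rule tensor_derivation_eqI) (use H H' in auto)
  qed
  then show "H z t = H' z t"
    by (rule derivation_along_sym_unique[OF hamiltonian_derivation_along[OF H]
          hamiltonian_derivation_along[OF H'] in_trace_one])
qed

lemma trace_hamiltonian_spec: "hamiltonian_spec (trace_hamiltonian db)"
  unfolding trace_hamiltonian_def
  by (rule theI'[of hamiltonian_spec], rule ex_ex1I, fact hamiltonian_exists, fact hamiltonian_unique)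

lemmas trace_hamiltonian_rules =
  derivation_alongD[OF hamiltonian_derivation_along[OF trace_hamiltonian_spec]]

text \<open>The specification demands a derivation only for generators \<open>w\<close>. The
  property passes to sums, scalar multiples and products; products need that
  \<open>N \<otimes> 1\<close> is central in \<open>T\<close>.\<close>

lemma derivation_trace_hamiltonian: "derivation (trace_hamiltonian db z)"
proof (induction z rule: sym_induct)
  case one
  have "trace_hamiltonian db 1 t = 0" for t
    using trace_hamiltonian_rules(3)[of 1 1 t] by (simp add: in_trace_one)
  then show ?case by (simp add: derivation_def clinearI)
next
  case (incl w)
  show ?case using trace_hamiltonian_spec by (elim conjE) (rule spec)
next
  case (add x y)
  note rules = derivationD[OF add(1)] derivationD[OF add(2)]
  show ?case
    by (simp add: derivation_def clinearI rules trace_hamiltonian_rules algebra_simps scaleC_add_right)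
next
  case (scale c x)
  note rules = derivationD[OF scale]
  show ?case
    by (simp add: derivation_def clinearI rules trace_hamiltonian_rules scaleC_add_right scaleC_scaleC
        mult.commute)
next
  case (mult x y)
  note rules = derivationD[OF mult(1)] derivationD[OF mult(2)]
  have swap: "necklace_in_trace z * (s * t) = s * (necklace_in_trace z * t)"
    for z :: "'a necklace_algebra" and s t
    unfolding necklace_in_trace_def by (metis tensor_left_central mult.assoc)
  show ?case
    by (simp add: derivation_def clinearI rules trace_hamiltonian_rules distrib_left distrib_right
        scaleC_add_right swap mult.assoc add_ac)
qed

text \<open>Both sides are derivations in \<open>z\<close> along the embedding of \<open>N\<close>,
  and they agree on generators by the specification. Through this identity the Poisson axioms on the
  image of \<open>N\<close> become those of the Lie-Poisson bracket.\<close>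

lemma trace_hamiltonian_in_trace:
  "trace_hamiltonian db z (necklace_in_trace y) = necklace_in_trace (necklace_poisson_bracket db z y)"
proof -
  have "derivation_along necklace_in_trace (\<lambda>z. necklace_in_trace (necklace_poisson_bracket db z y))"
  proof (rule derivation_alongI)
    note lin = clinearD[OF clinear_in_trace]
    fix x x' c
    show "necklace_in_trace (necklace_poisson_bracket db (x + x') y) =
        necklace_in_trace (necklace_poisson_bracket db x y) + necklace_in_trace (necklace_poisson_bracket db x' y)"
      by (simp add: necklace_poisson_bracket_def lie_poisson_rules lin)
    show "necklace_in_trace (necklace_poisson_bracket db (c *\<^sub>C x) y) =
        c *\<^sub>C necklace_in_trace (necklace_poisson_bracket db x y)"
      by (simp add: necklace_poisson_bracket_def lie_poisson_rules lin)
    show "necklace_in_trace (necklace_poisson_bracket db (x * x') y) =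
        necklace_in_trace x * necklace_in_trace (necklace_poisson_bracket db x' y) +
        necklace_in_trace x' * necklace_in_trace (necklace_poisson_bracket db x y)"
      by (simp add: necklace_poisson_bracket_def lie_poisson_rules ac_simps flip: lin(1) in_trace_mult)
  qed
  then show ?thesis
    by (rule derivation_along_sym_unique[
          OF hamiltonian_derivation_along[OF trace_hamiltonian_spec] _ in_trace_one])
      (use trace_hamiltonian_spec in \<open>simp add: necklace_in_trace_def\<close>)
qed

text \<open>The order is stated for the central subalgebra \<open>N \<otimes> 1\<close> of
  \<open>T\<close>, so \<open>H\<close> is precomposed with the inverse of the embedding. Linearity
  and the Leibniz rule in the second argument hold already on \<open>T\<close>; skew symmetry and
  the Jacobi identity are carried over from \<open>N\<close>.\<close>

lemma formal_poisson_order_trace_hamiltonian: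
  "formal_poisson_order (range necklace_in_trace)
    (\<lambda>x. trace_hamiltonian db (inv necklace_in_trace x))"
proof -
  note inv = inv_f_f[OF inj_necklace_in_trace]
  note lin = clinearD[OF clinear_in_trace]
  have "subalgebra (range (necklace_in_trace :: 'a necklace_algebra \<Rightarrow> _))"
    unfolding subalgebra_def
    by (auto simp flip: in_trace_one in_trace_mult lin(1,5))
  moreover have "poisson_bracket_on (range necklace_in_trace)
      (\<lambda>x. trace_hamiltonian db (inv necklace_in_trace x))"
    unfolding poisson_bracket_on_def ball_simps
  proof (intro conjI allI)
    fix x y z c
    let ?P = "necklace_poisson_bracket db" and ?i = "necklace_in_trace :: 'a necklace_algebra \<Rightarrow> _"
    let ?B = "\<lambda>x. trace_hamiltonian db (inv ?i x)"
    have B: "?B (?i x) (?i y) = ?i (?P x y)" for x y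
      by (simp add: inv trace_hamiltonian_in_trace)
    show "?B (?i x) (?i y) \<in> range ?i"
      by (simp add: B)
    show "?B (?i x) (?i y + ?i z) = ?B (?i x) (?i y) + ?B (?i x) (?i z)"
      "?B (?i x) (c *\<^sub>C ?i y) = c *\<^sub>C ?B (?i x) (?i y)"
      "?B (?i x) (?i y * ?i z) = ?B (?i x) (?i y) * ?i z + ?i y * ?B (?i x) (?i z)"
      by (rule derivationD[OF derivation_trace_hamiltonian])+
    show "?B (?i x) (?i y) = - ?B (?i y) (?i x)"
      unfolding B necklace_poisson_bracket_def by (subst lie_poisson_skew) (rule lin)
    show "?B (?i x) (?B (?i y) (?i z)) + ?B (?i y) (?B (?i z) (?i x)) + ?B (?i z) (?B (?i x) (?i y)) = 0"
      unfolding B lin(1)[symmetric]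
      using lie_poisson_jacobi[of x y z] by (simp add: necklace_poisson_bracket_def lin(4))
  qed
  ultimately show ?thesis
    unfolding formal_poisson_order_def
    by (simp add: inv derivation_trace_hamiltonian trace_hamiltonian_rules flip: lin(1,3,5) in_trace_mult)
      (simp add: necklace_in_trace_def tensor_left_central)
qed

end

theorem proposition10:
  fixes db :: "('a::complex_algebra_1, 'a) tensor \<Rightarrow> ('a, 'a) tensor"
  assumes "\<exists>S :: 'a set. finite S \<and> subalgebra hull S = UNIV"
    and "double_poisson_bracket db"
  shows "formal_poisson_order (range (necklace_in_trace :: 'a necklace_algebra \<Rightarrow> 'a trace_algebra))
    (\<lambda>x. trace_hamiltonian db (inv necklace_in_trace x))"
  using assms(2) by (rule formal_poisson_order_trace_hamiltonian)

end
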